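(* Let $\kappa$ be a signature wavelet and let $\sigma$ denote the signature with respect to $\kappa$. Let $f:\mathbb{R}\to\mathbb{R}$ be a locally integrable function of polynomial growth, and let $b\in\mathbb{R}$ be such that $f$ is smooth in a neighborhood of $b$. If there is $k_0\in\mathbb{N}_0$ such that $f^{(k)}(b)=0$ for all $k\ge k_0$, then $\sigma f(b)=0$. Consequently, if $f:\mathbb{R}\to\mathbb{R}$ is a locally integrable function of polynomial growth that coincides with a polynomial on an open set $U\subset\mathbb{R}$, then $\sigma f(b)=0$ for every $b\in U$. In particular, $\operatorname{supp}\sigma f\subseteq\operatorname{supp} f$.
   Context: The Fourier transform is $\widehat f(\omega)=\int_{\mathbb{R}}e^{-i\omega x}f(x)\,dx$. A signature wavelet is a non-zero complex-valued Schwartz function $\kappa\in\mathscr{S}(\mathbb{R},\mathbb{C})$ such that $\operatorname{supp}\widehat\kappa\subseteq[c,d]$ for some $0<c<d<\infty$ and $\widehat\kappa(\omega)\ge 0$ for all $\omega\in\mathbb{R}$. For $a>0$, $b\in\mathbb{R}$ put $\kappa_{a,b}(x)=\frac{1}{\sqrt a}\,\kappa\left(\frac{x-b}{a}\right)$. The pairing $\langle f,\phi\rangle$ of a tempered distribution with a Schwartz function is bilinear (no complex conjugation), i.e. $\langle f,\phi\rangle=\int f\phi\,dx$ for functions $f$. For $z\in\mathbb{C}\setminus\{0\}$, $\operatorname{sgn} z=z/|z|$, and $\operatorname{sgn}0=0$. The signature of $f$ at $b$ (with respect to $\kappa$) is $\sigma f(b)=\lim_{a\to0+}\operatorname{sgn}\langle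 f,\kappa_{a,b}\rangle$ if this limit exists in $\mathbb{C}$, and $\sigma f(b)=0$ otherwise. A function $f$ is of polynomial growth if there is $N\in\mathbb{N}$ with $f\in O(|x|^N)$ as $|x|\to\infty$. Here $\operatorname{supp}\sigma f$ is the closure of $\{b:\sigma f(b)\ne0\}$, and $\operatorname{supp} f$ is the support of $f$ as a distribution. *)

theory Defs
  imports
    "HOL-Analysis.Analysis"
    "HOL-Library.Landau_Symbols"
    "HOL-Library.Nonpos_Ints"
    "HOL-Computational_Algebra.Polynomial"
begin

definition nth_vderiv :: "nat \<Rightarrow> (real \<Rightarrow> 'a::real_normed_vector) \<Rightarrow> real \<Rightarrow> 'a" where
  "nth_vderiv k f = ((\<lambda>g x. vector_derivative g (at x)) ^^ k) f"

text \<open>Only meaningful for open \<open>S\<close>, because the derivatives are two-sided.\<close>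

definition smooth_on :: "real set \<Rightarrow> (real \<Rightarrow> 'a::real_normed_vector) \<Rightarrow> bool" where
  "smooth_on S f \<longleftrightarrow> (\<forall>k. \<forall>x\<in>S. nth_vderiv k f differentiable (at x))"

definition schwartz :: "(real \<Rightarrow> complex) \<Rightarrow> bool" where
  "schwartz \<phi> \<longleftrightarrow> smooth_on UNIV \<phi> \<and>
     (\<forall>m k. \<exists>C. \<forall>x. \<bar>x\<bar> ^ m * norm (nth_vderiv k \<phi> x) \<le> C)"

definition fourier :: "(real \<Rightarrow> complex) \<Rightarrow> real \<Rightarrow> complex" where
  "fourier f \<omega> = (LINT x|lebesgue. exp (- (\<i> * of_real \<omega> * of_real x)) * f x)"

definition fun_supp :: "(real \<Rightarrow> complex) \<Rightarrow> real set" where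
  "fun_supp g = closure {x. g x \<noteq> 0}"

definition signature_wavelet :: "(real \<Rightarrow> complex) \<Rightarrow> bool" where
  "signature_wavelet \<kappa> \<longleftrightarrow> schwartz \<kappa> \<and> (\<exists>x. \<kappa> x \<noteq> 0) \<and>
     (\<exists>c d. 0 < c \<and> c < d \<and> fun_supp (fourier \<kappa>) \<subseteq> {c..d}) \<and>
     (\<forall>\<omega>. fourier \<kappa> \<omega> \<in> \<real>\<^sub>\<ge>\<^sub>0)"

definition dilate_translate :: "(real \<Rightarrow> complex) \<Rightarrow> real \<Rightarrow> real \<Rightarrow> real \<Rightarrow> complex" where
  "dilate_translate \<kappa> a b x = of_real (1 / sqrt a) * \<kappa> ((x - b) / a)"

text \<open>Distributions are represented as functionals on complex-valued functions, of which only
  the values at Schwartz functions (in particular, at test functions) matter.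
  \<open>distr_of f\<close> is the distribution given by the real function \<open>f\<close>, through the
  bilinear pairing.\<close>

definition distr_of :: "(real \<Rightarrow> real) \<Rightarrow> (real \<Rightarrow> complex) \<Rightarrow> complex" where
  "distr_of f \<phi> = (LINT x|lebesgue. of_real (f x) * \<phi> x)"

definition signature :: "(real \<Rightarrow> complex) \<Rightarrow> ((real \<Rightarrow> complex) \<Rightarrow> complex) \<Rightarrow> real \<Rightarrow> complex" where
  "signature \<kappa> T b =
     (let s = (\<lambda>a. sgn (T (dilate_translate \<kappa> a b))) in
      if \<exists>l. (s \<longlongrightarrow> l) (at_right 0) then Lim (at_right 0) s else 0)"

definition test_function :: "(real \<Rightarrow> complex) \<Rightarrow> bool" where
  "test_function \<phi> \<longleftrightarrow> smooth_on UNIV \<phi> \<and> compact (fun_supp \<phi>)"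

definition distr_supp :: "((real \<Rightarrow> complex) \<Rightarrow> complex) \<Rightarrow> real set" where
  "distr_supp T =
     - \<Union>{U. open U \<and> (\<forall>\<phi>. test_function \<phi> \<and> fun_supp \<phi> \<subseteq> U \<longrightarrow> T \<phi> = 0)}"

definition locally_integrable :: "(real \<Rightarrow> real) \<Rightarrow> bool" where
  "locally_integrable f \<longleftrightarrow> (\<forall>K. compact K \<longrightarrow> f absolutely_integrable_on K)"

definition polynomial_growth :: "(real \<Rightarrow> real) \<Rightarrow> bool" where
  "polynomial_growth f \<longleftrightarrow> (\<exists>N::nat. f \<in> O[at_infinity](\<lambda>x. \<bar>x\<bar> ^ N))"

end

theory Submission
  imports Defs "HOL-Probability.Probability"
begin

text \<open>
  Put \<open>g t = f (b + t) - p t\<close>, where \<open>p\<close> is a polynomial that approximates \<open>f\<close> at \<open>b\<close> to every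
  order: the Taylor polynomial in the smooth case, the polynomial that coincides with \<open>f\<close> near \<open>b\<close>
  in the second case, and 0 if \<open>f\<close> vanishes near \<open>b\<close> as a distribution. The spectrum of \<open>\<kappa>\<close> stays
  away from 0, so all moments of \<open>\<kappa>\<close> vanish, and the pairing of \<open>f\<close> with the dilated wavelet is,
  up to the factor \<open>sqrt a\<close>, the average \<open>F a = \<integral> g (a y) \<kappa> y dy\<close>. This average decays faster than any
  power of \<open>a\<close>, but that says nothing about its sign; what has to be shown is that the sign does
  not converge to a non-zero number.

  The key is that the Mellin transform of \<open>F\<close> has zeros. Because the Fourier transform of \<open>\<kappa>\<close> is
  real, \<open>Re \<kappa>\<close> is even and \<open>Im \<kappa>\<close> is odd; together with the vanishing moments this kills the moments of
  \<open>Re \<kappa>\<close> of even order and those of \<open>Im \<kappa>\<close> of odd order even on each half-line separately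
  (\<open>signature_wavelet_half_moments\<close>). By Fubini's theorem, \<open>\<integral> Re (F a) a ^ (- k - 1) da\<close> over
  \<open>a > 0\<close> factors through these half-line moments and hence vanishes for all large even \<open>k\<close>, and
  likewise for \<open>Im F\<close> and odd \<open>k\<close> (\<open>mellin_transform_dilation_average\<close>).

  If the sign of \<open>F\<close> had a non-zero limit, then \<open>Re F\<close> or \<open>Im F\<close> would keep a strict sign on some
  interval \<open>(0, r)\<close>. For large \<open>k\<close> the weight \<open>a ^ (- k - 1)\<close> makes this interval dominate the rest of
  the integral, which therefore cannot be 0 (\<open>no_positivity_if_mellin_zeros\<close>).

  The inclusion of supports follows because a locally integrable function that vanishes as a
  distribution on an open set vanishes there almost everywhere (\<open>AE_zero_near_if_distr_zero\<close>).
\<close>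

section \<open>Uniqueness of the Fourier transform\<close>

text \<open>Both uniqueness results below, for the Fourier transform and for integrals over intervals, compare
  the positive and the negative part of a function as densities of measures; \<open>ennreal\<close> cuts off
  negative values.\<close>

lemma AE_zero_if_density_eq:
  fixes w :: "real \<Rightarrow> real"
  assumes [measurable]: "w \<in> borel_measurable borel"
    and eq: "density lborel (\<lambda>x. ennreal (w x)) = density lborel (\<lambda>x. ennreal (- w x))"
  shows "AE x in lborel. w x = 0"
proof -
  have "AE x in lborel. ennreal (w x) = ennreal (- w x)"
    using eq by (intro sigma_finite_measure.density_unique[OF sigma_finite_lborel]) auto
  then show ?thesis
  proof eventually_elim
    case (elim x)
    then show "w x = 0"
      by (cases "w x \<ge> 0") (auto simp: ennreal_neg dest!: sym[of 0])
  qed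
qed

text \<open>The positive and the negative part, normalized, are densities of two probability measures with the
  same characteristic function, so Levy's uniqueness theorem identifies them.\<close>

lemma fourier_uniqueness:
  fixes w :: "real \<Rightarrow> real"
  assumes w: "integrable lborel w"
    and zero: "\<And>t. (LINT x|lborel. iexp (t * x) * complex_of_real (w x)) = 0"
  shows "AE x in lborel. w x = 0"
proof -
  define c where "c = (LINT x|lborel. max 0 (w x))"
  have [measurable]: "w \<in> borel_measurable borel" using w by auto
  have wp: "integrable lborel (\<lambda>x. max 0 (w x))" and wn: "integrable lborel (\<lambda>x. max 0 (- w x))"
    using w by (auto intro!: integrable_max)
  \<comment> \<open>The transform at frequency 0 says that the positive and the negative part have the same mass \<open>c\<close>; dividing by it turns both into probability densities.\<close>
  have "complex_of_real (LINT x|lborel. w x) = 0"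
    using zero[of 0] by (simp flip: integral_complex_of_real)
  then have "(LINT x|lborel. w x) = 0" by simp
  moreover have "(LINT x|lborel. max 0 (w x)) - (LINT x|lborel. max 0 (- w x)) = (LINT x|lborel. w x)"
    by (subst Bochner_Integration.integral_diff[symmetric, OF wp wn]) (auto intro!: Bochner_Integration.integral_cong simp: max_def)
  ultimately have c': "(LINT x|lborel. max 0 (- w x)) = c" by (simp add: c_def)
  have "c \<ge> 0" unfolding c_def by (auto intro!: integral_nonneg_AE)
  show ?thesis
  proof (cases "c = 0")
    case True
    have "AE x in lborel. max 0 (w x) = 0"
      using True wp by (subst integral_nonneg_eq_0_iff_AE[symmetric]) (auto simp: c_def)
    moreover have "AE x in lborel. max 0 (- w x) = 0"
      using True wn by (subst integral_nonneg_eq_0_iff_AE[symmetric]) (auto simp: c')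
    ultimately show ?thesis by eventually_elim (auto simp: max_def split: if_splits)
  next
    case False
    with \<open>c \<ge> 0\<close> have c: "c > 0" by simp
    have distr: "real_distribution (density lborel (\<lambda>x. ennreal (max 0 (u x) / c)))"
      if u: "integrable lborel u" "(LINT x|lborel. max 0 (u x)) = c" for u :: "real \<Rightarrow> real"
    proof -
      have [measurable]: "u \<in> borel_measurable borel" using u by auto
      have "(\<integral>\<^sup>+x. ennreal (max 0 (u x) / c) \<partial>lborel) = ennreal (LINT x|lborel. max 0 (u x) / c)"
        using c u by (intro nn_integral_eq_integral) (auto intro!: integrable_divide_zero integrable_max)
      also have "\<dots> = 1" using u c by simp
      finally show ?thesis
        by (auto simp: real_distribution_def real_distribution_axioms_def emeasure_density
            intro!: prob_spaceI)
    qed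
    have char: "char (density lborel (\<lambda>x. ennreal (max 0 (u x) / c))) t =
        (LINT x|lborel. iexp (t * x) * complex_of_real (max 0 (u x))) / c"
      if [measurable]: "u \<in> borel_measurable borel" for u :: "real \<Rightarrow> real" and t
      unfolding char_def using c
      by (subst integral_density) (auto simp: scaleR_conv_of_real mult_ac simp flip: integral_divide_zero)
    have int: "integrable lborel (\<lambda>x. iexp (t * x) * complex_of_real (v x))"
      if "integrable lborel v" for v t
      using that by (intro Bochner_Integration.integrable_bound[OF that]) (auto simp: norm_mult)
    have "(LINT x|lborel. iexp (t * x) * complex_of_real (max 0 (w x))) -
        (LINT x|lborel. iexp (t * x) * complex_of_real (max 0 (- w x))) = 0" for t
      by (subst Bochner_Integration.integral_diff[symmetric, OF int[OF wp] int[OF wn]], subst zero[of t, symmetric])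
        (auto intro!: Bochner_Integration.integral_cong simp: max_def)
    then have "char (density lborel (\<lambda>x. ennreal (max 0 (w x) / c))) =
        char (density lborel (\<lambda>x. ennreal (max 0 (- w x) / c)))"
      by (intro ext) (simp add: char)
    then have eq: "density lborel (\<lambda>x. ennreal (max 0 (w x) / c)) = density lborel (\<lambda>x. ennreal (max 0 (- w x) / c))"
      using distr[of w] distr[of "\<lambda>x. - w x"] w c' by (intro Levy_uniqueness) (auto simp: c_def)
    have *: "ennreal (max 0 (u x) / c) = ennreal (u x / c)" for u :: "real \<Rightarrow> real" and x
      using c by (auto simp: max_def ennreal_neg divide_nonpos_pos)
    have "AE x in lborel. w x / c = 0"
      by (rule AE_zero_if_density_eq) (use eq in \<open>auto simp: *\<close>)
    then show ?thesis using c by simp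
  qed
qed

text \<open>The conjugate of \<open>u\<close> has zero transform as well (conjugation reflects the frequency),
  hence so do the real and the imaginary part, and the real case applies to each.\<close>

lemma fourier_uniqueness_complex:
  fixes u :: "real \<Rightarrow> complex"
  assumes u: "integrable lborel u"
    and zero: "\<And>t. (LINT x|lborel. iexp (t * x) * u x) = 0"
  shows "AE x in lborel. u x = 0"
proof -
  have [measurable]: "u \<in> borel_measurable borel" using u by auto
  have int: "integrable lborel (\<lambda>x. iexp (t * x) * v x)" if "integrable lborel v" for v :: "real \<Rightarrow> complex" and t
    using that by (intro Bochner_Integration.integrable_bound[OF that]) (auto simp: norm_mult)
  have cnj: "integrable lborel (\<lambda>x. cnj (u x))" using u by simp
  have zero_cnj: "(LINT x|lborel. iexp (t * x) * cnj (u x)) = 0" for t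
  proof -
    have "(LINT x|lborel. iexp (t * x) * cnj (u x)) = (LINT x|lborel. cnj (iexp ((- t) * x) * u x))"
      by (simp add: exp_cnj)
    also have "\<dots> = 0" by (simp only: Bochner_Integration.integral_cnj zero complex_cnj_zero)
    finally show ?thesis .
  qed
  have "AE x in lborel. Re (u x) = 0"
  proof (rule fourier_uniqueness)
    fix t
    have "(LINT x|lborel. iexp (t * x) * complex_of_real (Re (u x))) =
        (LINT x|lborel. (iexp (t * x) * u x + iexp (t * x) * cnj (u x)) / 2)"
      by (intro Bochner_Integration.integral_cong) (auto simp: complex_eq_iff algebra_simps)
    also have "\<dots> = 0"
      using zero[of t] zero_cnj[of t] int[OF u, of t] int[OF cnj, of t] by simp
    finally show "(LINT x|lborel. iexp (t * x) * complex_of_real (Re (u x))) = 0" .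
  qed (use u in auto)
  moreover have "AE x in lborel. Im (u x) = 0"
  proof -
    have Im_eq: "complex_of_real (Im z) = (- \<i> / 2) * (z - cnj z)" for z
      by (simp add: complex_eq_iff)
    show ?thesis
    proof (rule fourier_uniqueness)
      fix t
      have "(LINT x|lborel. iexp (t * x) * complex_of_real (Im (u x))) =
          (LINT x|lborel. (- \<i> / 2) * (iexp (t * x) * u x - iexp (t * x) * cnj (u x)))"
        by (simp only: Im_eq mult.left_commute right_diff_distrib)
      also have "\<dots> = 0"
        using zero[of t] zero_cnj[of t] int[OF u, of t] int[OF cnj, of t]
        by (subst integral_mult_right_zero, subst Bochner_Integration.integral_diff) auto
      finally show "(LINT x|lborel. iexp (t * x) * complex_of_real (Im (u x))) = 0" .
    qed (use u in auto)
  qed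
  ultimately show ?thesis by eventually_elim (auto simp: complex_eq_iff)
qed

section \<open>Moments of signature wavelets\<close>

lemma abs_le_one_plus_square: "\<bar>x\<bar> \<le> 1 + (x::real)\<^sup>2"
  using sum_power2_ge_zero[of "\<bar>x\<bar> - 1" 0]
  by (simp add: power2_eq_square algebra_simps)

lemma integrable_inverse_one_plus_square:
  "integrable lborel (\<lambda>x::real. inverse (1 + x\<^sup>2))"
  using integrable_inverse_1_plus_square by (simp add: set_integrable_def einterval_def)

lemma schwartz_borel_measurable:
  assumes "schwartz \<kappa>" shows "\<kappa> \<in> borel_measurable borel"
proof -
  have "\<kappa> differentiable (at x)" for x
    using assms unfolding schwartz_def smooth_on_def by (auto simp: nth_vderiv_def dest: spec[of _ 0])
  then show ?thesis
    by (intro borel_measurable_continuous_onI differentiable_imp_continuous_on)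
      (auto simp: differentiable_on_def intro: differentiable_at_withinI)
qed

lemma schwartz_decay:
  assumes "schwartz \<kappa>" shows "\<exists>C. \<forall>x. \<bar>x\<bar> ^ m * norm (\<kappa> x) \<le> C"
proof -
  have "\<exists>C. \<forall>x. \<bar>x\<bar> ^ m * norm (nth_vderiv 0 \<kappa> x) \<le> C"
    using assms unfolding schwartz_def by blast
  then show ?thesis by (simp add: nth_vderiv_def)
qed

text \<open>Powers of \<open>1 + x\<^sup>2\<close> are the weights against which growth and decay are
  measured throughout: unlike powers of \<open>\<bar>x\<bar>\<close>, they never vanish.\<close>

lemma schwartz_weighted_bound:
  assumes "schwartz \<kappa>" shows "\<exists>C. \<forall>x. (1 + x\<^sup>2) ^ M * norm (\<kappa> x) \<le> C"
proof -
  obtain C0 where C0: "\<And>x. \<bar>x\<bar> ^ 0 * norm (\<kappa> x) \<le> C0" using schwartz_decay[OF assms] by blast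
  obtain C1 where C1: "\<And>x. \<bar>x\<bar> ^ (2 * M) * norm (\<kappa> x) \<le> C1" using schwartz_decay[OF assms] by blast
  have bnd: "(1 + x\<^sup>2) ^ M * norm (\<kappa> x) \<le> 2 ^ M * (C0 + C1)" for x
  proof -
    have "1 + x\<^sup>2 \<le> 2 * max 1 (x\<^sup>2)" by simp
    then have "(1 + x\<^sup>2) ^ M \<le> (2 * max 1 (x\<^sup>2)) ^ M" by (intro power_mono) auto
    also have "\<dots> \<le> 2 ^ M * (1 + \<bar>x\<bar> ^ (2 * M))"
      by (auto simp: power_mult_distrib max_def power_mult)
    finally have "(1 + x\<^sup>2) ^ M * norm (\<kappa> x) \<le> 2 ^ M * (1 + \<bar>x\<bar> ^ (2 * M)) * norm (\<kappa> x)"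
      by (intro mult_right_mono) auto
    also have "\<dots> = 2 ^ M * (norm (\<kappa> x) + \<bar>x\<bar> ^ (2 * M) * norm (\<kappa> x))" by (simp add: algebra_simps)
    also have "\<dots> \<le> 2 ^ M * (C0 + C1)" using C0[of x] C1[of x] by (intro mult_left_mono) auto
    finally show ?thesis .
  qed
  then show ?thesis by blast
qed

lemma schwartz_moment_integrable:
  assumes "schwartz \<kappa>" shows "integrable lborel (\<lambda>x. complex_of_real (x ^ k) * \<kappa> x)"
proof -
  have [measurable]: "\<kappa> \<in> borel_measurable borel" by (rule schwartz_borel_measurable[OF assms])
  obtain C where C: "\<And>x. (1 + x\<^sup>2) ^ (k + 1) * norm (\<kappa> x) \<le> C"
    using schwartz_weighted_bound[OF assms] by blast
  show ?thesis
  proof (rule Bochner_Integration.integrable_bound)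
    show "integrable lborel (\<lambda>x. C * inverse (1 + x\<^sup>2))"
      using integrable_inverse_one_plus_square by auto
    show "AE x in lborel. norm (complex_of_real (x ^ k) * \<kappa> x) \<le> norm (C * inverse (1 + x\<^sup>2))"
    proof (rule AE_I2)
      fix x :: real
      have pos: "1 + x\<^sup>2 > 0" by (simp add: add_pos_nonneg)
      have "\<bar>x\<bar> ^ k \<le> (1 + x\<^sup>2) ^ k" by (intro power_mono abs_le_one_plus_square) auto
      then have "\<bar>x\<bar> ^ k * norm (\<kappa> x) * (1 + x\<^sup>2) \<le> (1 + x\<^sup>2) ^ k * norm (\<kappa> x) * (1 + x\<^sup>2)"
        using pos by (intro mult_right_mono) auto
      also have "\<dots> \<le> C" using C[of x] by (simp add: algebra_simps)
      finally have "\<bar>x\<bar> ^ k * norm (\<kappa> x) \<le> C * inverse (1 + x\<^sup>2)" using pos by (simp add: field_simps)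
      then show "norm (complex_of_real (x ^ k) * \<kappa> x) \<le> norm (C * inverse (1 + x\<^sup>2))"
        by (simp add: norm_mult power_abs norm_power)
    qed
  qed simp
qed

lemma fourier_eq_lborel:
  assumes [measurable]: "\<kappa> \<in> borel_measurable borel"
  shows "fourier \<kappa> (- t) = (LINT x|lborel. iexp (t * x) * \<kappa> x)"
  unfolding fourier_def by (subst integral_completion) (auto simp: mult.assoc)

text \<open>The transform is real, and the transform of the reflected conjugate is the conjugate transform; so
  both functions have the same transform, and uniqueness applies. It follows that \<open>Re \<kappa>\<close>
  is even and \<open>Im \<kappa>\<close> is odd, up to a null set.\<close>

lemma signature_wavelet_hermitian:
  assumes "signature_wavelet \<kappa>"
  shows "AE x in lborel. \<kappa> (- x) = cnj (\<kappa> x)"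
proof -
  have s: "schwartz \<kappa>" using assms by (simp add: signature_wavelet_def)
  have [measurable]: "\<kappa> \<in> borel_measurable borel" by (rule schwartz_borel_measurable[OF s])
  have k: "integrable lborel \<kappa>" using schwartz_moment_integrable[OF s, of 0] by simp
  have k': "integrable lborel (\<lambda>x. cnj (\<kappa> (- x)))"
    using lborel_integrable_real_affine[OF k, of "-1" 0] by simp
  have int: "integrable lborel (\<lambda>x. iexp (t * x) * v x)" if "integrable lborel v" for v :: "real \<Rightarrow> complex" and t
    using that by (intro Bochner_Integration.integrable_bound[OF that]) (auto simp: norm_mult)
  have "AE x in lborel. \<kappa> x - cnj (\<kappa> (- x)) = 0"
  proof (rule fourier_uniqueness_complex)
    show "integrable lborel (\<lambda>x. \<kappa> x - cnj (\<kappa> (- x)))" using k k' by simp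
    fix t
    have "(LINT x|lborel. iexp (t * x) * cnj (\<kappa> (- x))) = (LINT x|lborel. cnj (iexp (t * x) * \<kappa> x))"
      by (subst lborel_integral_real_affine[where c="-1" and t=0]) (auto simp: exp_cnj)
    also have "\<dots> = cnj (fourier \<kappa> (- t))" by (simp only: Bochner_Integration.integral_cnj fourier_eq_lborel \<open>\<kappa> \<in> borel_measurable borel\<close>)
    also have "\<dots> = fourier \<kappa> (- t)"
    proof -
      have "fourier \<kappa> (- t) \<in> \<real>\<^sub>\<ge>\<^sub>0" using assms by (simp add: signature_wavelet_def)
      then show ?thesis by (auto simp: complex_nonneg_Reals_iff complex_eq_iff)
    qed
    finally have "(LINT x|lborel. iexp (t * x) * cnj (\<kappa> (- x))) = (LINT x|lborel. iexp (t * x) * \<kappa> x)"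
      by (simp add: fourier_eq_lborel)
    then show "(LINT x|lborel. iexp (t * x) * (\<kappa> x - cnj (\<kappa> (- x)))) = 0"
      unfolding right_diff_distrib by (subst Bochner_Integration.integral_diff[OF int[OF k] int[OF k']]) simp
  qed
  then show ?thesis by eventually_elim (auto simp: complex_eq_iff)
qed

text \<open>The transform vanishes near frequency 0. Expanding the exponential to order \<open>n\<close> in
  \<open>0 = \<integral> exp (i t x) \<kappa> x\<close>, where the moments below \<open>n\<close>
  vanish by induction, bounds the \<open>n\<close>-th moment by a multiple of \<open>t\<close>, for every
  \<open>t > 0\<close>.\<close>

lemma signature_wavelet_moment_zero:
  assumes "signature_wavelet \<kappa>"
  shows "(LINT x|lborel. complex_of_real (x ^ n) * \<kappa> x) = 0"
proof (induction n rule: less_induct)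
  case (less n)
  define m where "m k = (LINT x|lborel. complex_of_real (x ^ k) * \<kappa> x)" for k
  have s: "schwartz \<kappa>" using assms by (simp add: signature_wavelet_def)
  have [measurable]: "\<kappa> \<in> borel_measurable borel" by (rule schwartz_borel_measurable[OF s])
  have int: "integrable lborel (\<lambda>x. complex_of_real (x ^ k) * \<kappa> x)" for k
    by (rule schwartz_moment_integrable[OF s])
  have k: "integrable lborel \<kappa>" using int[of 0] by simp
  \<comment> \<open>With the sign convention of the transform, \<open>t > 0\<close> is the negative frequency \<open>- t\<close>, which lies outside the spectrum.\<close>
  have F0: "(LINT x|lborel. iexp (t * x) * \<kappa> x) = 0" if "t > 0" for t
  proof -
    obtain c d where "0 < c" "fun_supp (fourier \<kappa>) \<subseteq> {c..d}"
      using assms unfolding signature_wavelet_def by blast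
    then have "- t \<notin> fun_supp (fourier \<kappa>)" using that by auto
    then have "fourier \<kappa> (- t) = 0"
      unfolding fun_supp_def using closure_subset by (metis (mono_tags, lifting) mem_Collect_eq subsetD)
    then show ?thesis by (simp add: fourier_eq_lborel)
  qed
  define K where "K = (LINT x|lborel. norm (complex_of_real (x ^ Suc n) * \<kappa> x))"
  have bound: "norm (m n) \<le> t * (fact n * K)" if t: "t > 0" for t
  proof -
    define P where "P x = (\<Sum>j\<le>n. (\<i> * complex_of_real (t * x)) ^ j / fact j)" for x
    have P: "P x * \<kappa> x = (\<Sum>j\<le>n. (\<i> * t) ^ j / fact j * (complex_of_real (x ^ j) * \<kappa> x))" for x
      unfolding P_def sum_distrib_right by (intro sum.cong) (auto simp: power_mult_distrib)
    have intP: "integrable lborel (\<lambda>x. P x * \<kappa> x)"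
      unfolding P by (intro Bochner_Integration.integrable_sum integrable_mult_right int)
    have intE: "integrable lborel (\<lambda>x. iexp (t * x) * \<kappa> x)"
      by (rule Bochner_Integration.integrable_bound[OF k]) (auto simp: norm_mult)
    have "(LINT x|lborel. P x * \<kappa> x) = (\<Sum>j\<le>n. (\<i> * t) ^ j / fact j * m j)"
      unfolding P m_def using int by (subst Bochner_Integration.integral_sum) (auto intro!: sum.cong)
    \<comment> \<open>The lower moments vanish by the induction hypothesis, so only the term of degree \<open>n\<close> of the exponential series survives.\<close>
    also have "\<dots> = (\<Sum>j\<in>{n}. (\<i> * t) ^ j / fact j * m j)"
      using less by (intro sum.mono_neutral_right) (auto simp: m_def)
    finally have "(LINT x|lborel. P x * \<kappa> x) = (\<i> * t) ^ n / fact n * m n" by simp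
    then have "norm ((\<i> * t) ^ n / fact n * m n) = norm (LINT x|lborel. iexp (t * x) * \<kappa> x - P x * \<kappa> x)"
      using F0[OF t] intP intE by simp
    also have "\<dots> \<le> (LINT x|lborel. norm (iexp (t * x) * \<kappa> x - P x * \<kappa> x))"
      by (rule integral_norm_bound)
    also have "\<dots> \<le> (LINT x|lborel. t ^ Suc n * norm (complex_of_real (x ^ Suc n) * \<kappa> x))"
    proof (rule integral_mono)
      fix x
      have "norm (iexp (t * x) * \<kappa> x - P x * \<kappa> x) = norm (iexp (t * x) - P x) * norm (\<kappa> x)"
        by (simp add: norm_mult flip: left_diff_distrib)
      also have "\<dots> \<le> \<bar>t * x\<bar> ^ Suc n / fact (Suc n) * norm (\<kappa> x)"
        unfolding P_def by (intro mult_right_mono iexp_approx1) auto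
      also have "\<dots> \<le> \<bar>t * x\<bar> ^ Suc n / 1 * norm (\<kappa> x)"
        by (intro mult_right_mono divide_left_mono fact_ge_1) auto
      also have "\<dots> = t ^ Suc n * norm (complex_of_real (x ^ Suc n) * \<kappa> x)"
        using t by (simp add: norm_mult norm_power power_mult_distrib abs_mult del: power_Suc)
      finally show "norm (iexp (t * x) * \<kappa> x - P x * \<kappa> x) \<le> t ^ Suc n * norm (complex_of_real (x ^ Suc n) * \<kappa> x)" .
    qed (use int[of "Suc n"] intP intE in \<open>auto simp del: power_Suc\<close>)
    also have "\<dots> = t ^ Suc n * K" by (simp add: K_def del: power_Suc)
    finally have "t ^ n * norm (m n) \<le> t ^ n * (t * (fact n * K))"
      using t by (simp add: norm_mult norm_divide norm_power field_simps)
    then show ?thesis using t by simp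
  qed
  have "((\<lambda>t. t * (fact n * K)) \<longlongrightarrow> 0 * (fact n * K)) (at_right 0)" by (intro tendsto_intros)
  then have "norm (m n) \<le> 0"
    by (intro tendsto_lowerbound[where F="at_right (0::real)"])
      (auto simp: eventually_at_right_less intro!: eventually_mono[OF eventually_at_right_less] bound)
  then show ?case by (simp add: m_def)
qed

text \<open>By symmetry the two halves contribute equally to the total integral, which is 0.\<close>

lemma half_line_integrals_zero:
  fixes r :: "real \<Rightarrow> real"
  assumes r: "integrable lborel r" and even: "AE x in lborel. r (- x) = r x"
    and zero: "(LINT x|lborel. r x) = 0"
  shows "(LINT x|lborel. indicator {0<..} x * r x) = 0" "(LINT x|lborel. indicator {..<0} x * r x) = 0"
proof -
  have [measurable]: "r \<in> borel_measurable borel" using r by auto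
  have i: "integrable lborel (\<lambda>x. indicator A x * r x)" if [measurable]: "A \<in> sets borel" for A
    using r by (rule Bochner_Integration.integrable_bound) (auto simp: indicator_def)
  have "(LINT x|lborel. indicator {0<..} x * r x) = (LINT x|lborel. indicator {0<..} (- x) * r (- x))"
    by (subst lborel_integral_real_affine[where c="-1" and t=0]) auto
  also have "\<dots> = (LINT x|lborel. indicator {..<0} x * r x)"
    by (rule integral_cong_AE) (use even in \<open>auto simp: indicator_def\<close>)
  finally have eq: "(LINT x|lborel. indicator {0<..} x * r x) = (LINT x|lborel. indicator {..<0} x * r x)" .
  have "(LINT x|lborel. r x) = (LINT x|lborel. indicator {0<..} x * r x + indicator {..<0} x * r x)"
  proof (rule integral_cong_AE)
    show "AE x in lborel. r x = indicator {0<..} x * r x + indicator {..<0} x * r x"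
      using AE_lborel_singleton[of 0] by eventually_elim (auto simp: indicator_def)
  qed auto
  also have "\<dots> = (LINT x|lborel. indicator {0<..} x * r x) + (LINT x|lborel. indicator {..<0} x * r x)"
    by (intro Bochner_Integration.integral_add i) auto
  finally show "(LINT x|lborel. indicator {0<..} x * r x) = 0" "(LINT x|lborel. indicator {..<0} x * r x) = 0"
    using eq zero by auto
qed

text \<open>For \<open>k\<close> of the right parity, \<open>y ^ k\<close> times the real or imaginary part
  of \<open>\<kappa>\<close> is an even function with integral 0, so that even its integrals over half-lines
  vanish.\<close>

lemma signature_wavelet_half_moments:
  assumes "signature_wavelet \<kappa>"
  shows "even k \<Longrightarrow> (LINT y|lborel. indicator {0<..} y * (y ^ k * Re (\<kappa> y))) = 0"
    and "even k \<Longrightarrow> (LINT y|lborel. indicator {..<0} y * (y ^ k * Re (\<kappa> y))) = 0"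
    and "odd k \<Longrightarrow> (LINT y|lborel. indicator {0<..} y * (y ^ k * Im (\<kappa> y))) = 0"
    and "odd k \<Longrightarrow> (LINT y|lborel. indicator {..<0} y * (y ^ k * Im (\<kappa> y))) = 0"
proof -
  have s: "schwartz \<kappa>" using assms by (simp add: signature_wavelet_def)
  note int = schwartz_moment_integrable[OF s, of k]
  have re: "integrable lborel (\<lambda>y. y ^ k * Re (\<kappa> y))" "(LINT y|lborel. y ^ k * Re (\<kappa> y)) = 0"
    using integrable_Re[OF int] integral_Re[OF int] signature_wavelet_moment_zero[OF assms, of k] by (auto simp flip: of_real_power)
  have im: "integrable lborel (\<lambda>y. y ^ k * Im (\<kappa> y))" "(LINT y|lborel. y ^ k * Im (\<kappa> y)) = 0"
    using integrable_Im[OF int] integral_Im[OF int] signature_wavelet_moment_zero[OF assms, of k] by (auto simp flip: of_real_power)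
  note herm = signature_wavelet_hermitian[OF assms]
  show "even k \<Longrightarrow> (LINT y|lborel. indicator {0<..} y * (y ^ k * Re (\<kappa> y))) = 0"
    "even k \<Longrightarrow> (LINT y|lborel. indicator {..<0} y * (y ^ k * Re (\<kappa> y))) = 0"
    by (rule half_line_integrals_zero[OF re(1) _ re(2)], use herm in eventually_elim, simp)+
  show "odd k \<Longrightarrow> (LINT y|lborel. indicator {0<..} y * (y ^ k * Im (\<kappa> y))) = 0"
    "odd k \<Longrightarrow> (LINT y|lborel. indicator {..<0} y * (y ^ k * Im (\<kappa> y))) = 0"
    by (rule half_line_integrals_zero[OF im(1) _ im(2)], use herm in eventually_elim, simp)+
qed

section \<open>The Mellin transform of averages over dilations\<close>

text \<open>The substitution \<open>t = a y\<close> for fixed \<open>y\<close>. It maps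
  \<open>a > 0\<close> to the half-line on the side of \<open>y\<close>, so that a Mellin integral of
  \<open>g\<close> over one half-line appears.\<close>

lemma dilation_moment:
  fixes g :: "real \<Rightarrow> real"
  assumes g: "integrable lborel (\<lambda>t. g t / \<bar>t\<bar> ^ Suc k)" and y: "y \<noteq> 0"
  shows "integrable lborel (\<lambda>a. indicator {0<..} a * (g (a * y) / a ^ Suc k))"
    and "(LINT a|lborel. indicator {0<..} a * (g (a * y) / a ^ Suc k)) =
      \<bar>y\<bar> ^ k * (LINT t|lborel. (if y > 0 then indicator {0<..} t else indicator {..<0} t) * (g t / \<bar>t\<bar> ^ Suc k))"
proof -
  define I :: "real \<Rightarrow> real" where "I t = (if y > 0 then indicator {0<..} t else indicator {..<0} t)" for t
  define u where "u t = I t * (g t / \<bar>t\<bar> ^ Suc k)" for t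
  have [measurable]: "I \<in> borel_measurable borel" unfolding I_def by measurable
  have u: "integrable lborel u"
  proof (rule Bochner_Integration.integrable_bound[OF g])
    show "u \<in> borel_measurable lborel"
      unfolding u_def using borel_measurable_integrable[OF g] by (intro borel_measurable_times) auto
    show "AE t in lborel. norm (u t) \<le> norm (g t / \<bar>t\<bar> ^ Suc k)"
      unfolding u_def by (intro AE_I2) (auto simp: I_def indicator_def simp del: power_Suc)
  qed
  have eq: "indicator {0<..} a * (g (a * y) / a ^ Suc k) = \<bar>y\<bar> ^ Suc k * u (0 + y * a)" for a
  proof (cases "a > 0")
    case True
    then have "I (y * a) = 1" using y by (auto simp: I_def zero_less_mult_iff mult_less_0_iff)
    moreover have "\<bar>y * a\<bar> ^ Suc k = \<bar>y\<bar> ^ Suc k * a ^ Suc k"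
      using True by (simp only: abs_mult abs_of_pos power_mult_distrib)
    ultimately show ?thesis using True y by (simp add: u_def mult.commute del: power_Suc)
  next
    case False
    then have "I (y * a) = 0" using y by (auto simp: I_def zero_less_mult_iff mult_less_0_iff)
    then show ?thesis using False by (simp add: u_def)
  qed
  show "integrable lborel (\<lambda>a. indicator {0<..} a * (g (a * y) / a ^ Suc k))"
    unfolding eq using y by (intro integrable_mult_right lborel_integrable_real_affine u) auto
  have "(LINT t|lborel. u t) = \<bar>y\<bar> * (LINT a|lborel. u (0 + y * a))"
    using y by (subst lborel_integral_real_affine[of y _ 0]) auto
  then show "(LINT a|lborel. indicator {0<..} a * (g (a * y) / a ^ Suc k)) =
      \<bar>y\<bar> ^ k * (LINT t|lborel. (if y > 0 then indicator {0<..} t else indicator {..<0} t) * (g t / \<bar>t\<bar> ^ Suc k))"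
    unfolding eq u_def[symmetric] I_def[symmetric] by (simp add: u_def[symmetric] I_def[symmetric] mult_ac)
qed

text \<open>By Fubini's theorem, the Mellin transform of
  \<open>a \<mapsto> \<integral> g (a y) q y dy\<close> is a sum over the two half-lines of products:
  a Mellin integral of \<open>g\<close> times the corresponding half-line moment of \<open>q\<close>. If both
  half-line moments vanish, so does the transform.\<close>

lemma mellin_transform_dilation_average:
  fixes g q :: "real \<Rightarrow> real"
  assumes [measurable]: "g \<in> borel_measurable borel" "q \<in> borel_measurable borel"
    and g: "integrable lborel (\<lambda>t. g t / \<bar>t\<bar> ^ Suc k)"
    and q: "integrable lborel (\<lambda>y. y ^ k * q y)"
  defines "h \<equiv> \<lambda>a. LINT y|lborel. g (a * y) * q y"
  shows "integrable lborel (\<lambda>a. indicator {0<..} a * (h a / a ^ Suc k))"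
    and "(LINT y|lborel. indicator {0<..} y * (y ^ k * q y)) = 0 \<Longrightarrow>
      (LINT y|lborel. indicator {..<0} y * (y ^ k * q y)) = 0 \<Longrightarrow>
      (LINT a|lborel. indicator {0<..} a * (h a / a ^ Suc k)) = 0"
proof -
  define \<Phi> where "\<Phi> y a = indicator {0<..} a * (g (a * y) / a ^ Suc k) * q y" for y a
  \<comment> \<open>\<open>J g y\<close> is the Mellin integral of \<open>g\<close> over the half-line that contains \<open>y\<close>, so it depends only on the sign of \<open>y\<close>.\<close>
  define J where "J g y = (LINT t|lborel. (if y > 0 then indicator {0<..} t else indicator {..<0} t) * (g t / \<bar>t\<bar> ^ Suc k))"
    for g :: "real \<Rightarrow> real" and y :: real
  have [measurable]: "(\<lambda>(y, a). \<Phi> y a) \<in> borel_measurable (lborel \<Otimes>\<^sub>M lborel)"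
    unfolding \<Phi>_def by measurable
  have J: "J g y = (if y > 0 then J g 1 else J g (- 1))" for g y by (simp add: J_def)
  have Jm[measurable]: "J g \<in> borel_measurable borel" for g
  proof -
    have "(\<lambda>y::real. if y > 0 then J g 1 else J g (- 1)) \<in> borel_measurable borel" by measurable
    then show ?thesis by (subst ext[OF J])
  qed
  have g_abs: "integrable lborel (\<lambda>t. \<bar>g t\<bar> / \<bar>t\<bar> ^ Suc k)"
    using integrable_norm[OF g] by (simp add: power_abs)
  have abs: "norm (\<Phi> y a) = indicator {0<..} a * (\<bar>g (a * y)\<bar> / a ^ Suc k) * \<bar>q y\<bar>" for y a
    by (cases "a > 0") (auto simp: \<Phi>_def abs_mult)
  have inner: "(LINT a|lborel. \<Phi> y a) = \<bar>y\<bar> ^ k * J g y * q y"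
      "(LINT a|lborel. norm (\<Phi> y a)) = \<bar>y\<bar> ^ k * J (\<lambda>t. \<bar>g t\<bar>) y * \<bar>q y\<bar>"
      "integrable lborel (\<Phi> y)" if "y \<noteq> 0" for y
  proof -
    note d = dilation_moment[OF g that] dilation_moment[OF g_abs that]
    show "(LINT a|lborel. \<Phi> y a) = \<bar>y\<bar> ^ k * J g y * q y"
      unfolding \<Phi>_def integral_mult_left_zero d(2) J_def ..
    show "(LINT a|lborel. norm (\<Phi> y a)) = \<bar>y\<bar> ^ k * J (\<lambda>t. \<bar>g t\<bar>) y * \<bar>q y\<bar>"
      unfolding abs integral_mult_left_zero d(4) J_def ..
    show "integrable lborel (\<Phi> y)"
      unfolding \<Phi>_def by (intro integrable_mult_left d(1))
  qed
  have Jq: "integrable lborel (\<lambda>y. \<bar>y\<bar> ^ k * J u y * \<bar>q y\<bar>)" for u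
  proof (rule Bochner_Integration.integrable_bound)
    show "integrable lborel (\<lambda>y. (\<bar>J u 1\<bar> + \<bar>J u (- 1)\<bar>) * (y ^ k * q y))"
      using q by simp
    show "AE y in lborel. norm (\<bar>y\<bar> ^ k * J u y * \<bar>q y\<bar>) \<le> norm ((\<bar>J u 1\<bar> + \<bar>J u (- 1)\<bar>) * (y ^ k * q y))"
    proof (rule AE_I2)
      fix y
      have "\<bar>J u y\<bar> \<le> \<bar>J u 1\<bar> + \<bar>J u (- 1)\<bar>" by (subst J) auto
      then have "\<bar>J u y\<bar> * (\<bar>y\<bar> ^ k * \<bar>q y\<bar>) \<le> (\<bar>J u 1\<bar> + \<bar>J u (- 1)\<bar>) * (\<bar>y\<bar> ^ k * \<bar>q y\<bar>)"
        by (intro mult_right_mono) auto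
      then show "norm (\<bar>y\<bar> ^ k * J u y * \<bar>q y\<bar>) \<le> norm ((\<bar>J u 1\<bar> + \<bar>J u (- 1)\<bar>) * (y ^ k * q y))"
        by (simp add: abs_mult power_abs mult_ac)
    qed
  qed measurable
  have ae: "AE y in lborel. (y::real) \<noteq> 0" by (rule AE_lborel_singleton)
  have int: "integrable (lborel \<Otimes>\<^sub>M lborel) (\<lambda>(y, a). \<Phi> y a)"
  proof (rule lborel_pair.Fubini_integrable)
    have "(\<lambda>(y, a). norm (\<Phi> y a)) \<in> borel_measurable (lborel \<Otimes>\<^sub>M lborel)" by measurable
    then have m: "(\<lambda>y. LINT a|lborel. norm (\<Phi> y a)) \<in> borel_measurable lborel"
      by (rule lborel.borel_measurable_lebesgue_integral)
    have "AE y in lborel. \<bar>y\<bar> ^ k * J (\<lambda>t. \<bar>g t\<bar>) y * \<bar>q y\<bar> = (LINT a|lborel. norm (\<Phi> y a))"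
      using ae by eventually_elim (rule inner(2)[symmetric])
    then show "integrable lborel (\<lambda>y. LINT a|lborel. norm (case (y, a) of (y, a) \<Rightarrow> \<Phi> y a))"
      unfolding prod.case by (rule integrable_cong_AE_imp[OF Jq m])
    show "AE y in lborel. integrable lborel (\<lambda>a. case (y, a) of (y, a) \<Rightarrow> \<Phi> y a)"
      using ae by eventually_elim (simp add: inner)
  qed fact
  have h: "(LINT y|lborel. \<Phi> y a) = indicator {0<..} a * (h a / a ^ Suc k)" for a
  proof -
    have "\<Phi> y a = indicator {0<..} a / a ^ Suc k * (g (a * y) * q y)" for y by (simp add: \<Phi>_def)
    then show ?thesis by (simp only: integral_mult_right_zero h_def) simp
  qed
  show "integrable lborel (\<lambda>a. indicator {0<..} a * (h a / a ^ Suc k))"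
    using lborel_pair.integrable_snd[OF int] by (simp add: h)
  assume pos: "(LINT y|lborel. indicator {0<..} y * (y ^ k * q y)) = 0"
    and neg: "(LINT y|lborel. indicator {..<0} y * (y ^ k * q y)) = 0"
  have i: "integrable lborel (\<lambda>y. indicator A y * (y ^ k * q y))" if [measurable]: "A \<in> sets borel" for A
    using q by (rule Bochner_Integration.integrable_bound) (auto simp: indicator_def)
  have "(LINT a|lborel. indicator {0<..} a * (h a / a ^ Suc k)) = (LINT a|lborel. LINT y|lborel. \<Phi> y a)"
    by (simp add: h)
  also have "\<dots> = (LINT y|lborel. LINT a|lborel. \<Phi> y a)"
    by (rule lborel_pair.Fubini_integral[OF int])
  also have "\<dots> = (LINT y|lborel. J g 1 * (indicator {0<..} y * (y ^ k * q y)) +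
      J g (- 1) * (- 1) ^ k * (indicator {..<0} y * (y ^ k * q y)))"
  proof (rule integral_cong_AE)
    show "AE y in lborel. (LINT a|lborel. \<Phi> y a) = J g 1 * (indicator {0<..} y * (y ^ k * q y)) +
        J g (- 1) * (- 1) ^ k * (indicator {..<0} y * (y ^ k * q y))"
      using ae
    proof eventually_elim
      case (elim y)
      show ?case
      proof (cases "y > 0")
        case True
        then show ?thesis using inner(1)[OF elim] J[of g y] by (simp add: algebra_simps)
      next
        case False
        then have "y < 0" using elim by simp
        moreover have "(- y) ^ k = (- 1) ^ k * y ^ k" by (rule power_minus)
        ultimately show ?thesis using inner(1)[OF elim] J[of g y] by (simp add: algebra_simps)
      qed
    qed
  qed measurable
  also have "\<dots> = J g 1 * (LINT y|lborel. indicator {0<..} y * (y ^ k * q y)) +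
      J g (- 1) * (- 1) ^ k * (LINT y|lborel. indicator {..<0} y * (y ^ k * q y))"
    using i by (subst Bochner_Integration.integral_add) simp_all
  finally show "(LINT a|lborel. indicator {0<..} a * (h a / a ^ Suc k)) = 0"
    using pos neg by simp
qed

text \<open>The idea of Landau's theorem on Dirichlet series with positive coefficients: for large
  \<open>k\<close> the weight \<open>a ^ (- k)\<close> concentrates near 0. Normalized as
  \<open>(r / a) ^ j\<close> with \<open>k = N + j\<close>, it is at least 1 on
  \<open>(0, r)\<close>, where \<open>h > 0\<close> contributes a fixed positive amount, and at most
  \<open>(1/2) ^ j\<close> beyond \<open>2 r\<close>, so the integral cannot vanish for infinitely many
  \<open>k\<close>.\<close>

lemma no_positivity_if_mellin_zeros:
  fixes h :: "real \<Rightarrow> real"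
  assumes ints: "\<And>k. k \<ge> N \<Longrightarrow> integrable lborel (\<lambda>a. indicator {0<..} a * (h a / a ^ Suc k))"
    and zero: "\<exists>\<^sub>\<infinity>k. (LINT a|lborel. indicator {0<..} a * (h a / a ^ Suc k)) = 0"
  shows "\<not> (\<forall>\<^sub>F a in at_right 0. h a > 0)"
proof
  assume "\<forall>\<^sub>F a in at_right 0. h a > 0"
  then obtain r0 where r0: "r0 > 0" "\<And>a. 0 < a \<Longrightarrow> a < r0 \<Longrightarrow> h a > 0"
    unfolding eventually_at_right_field by auto
  \<comment> \<open>\<open>h\<close> is positive on twice the interval from which the lower bound \<open>c\<close> is taken; this factor 2 gives the decay \<open>(1/2) ^ j\<close> of what lies beyond.\<close>
  define r where "r = r0 / 2"
  have r: "r > 0" "\<And>a. 0 < a \<Longrightarrow> a < 2 * r \<Longrightarrow> h a > 0" using r0 by (auto simp: r_def)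
  define w where "w a = indicator {0<..} a * (h a / a ^ Suc N)" for a
  have w: "integrable lborel w" using ints[of N] by (simp add: w_def[abs_def])
  then have [measurable]: "w \<in> borel_measurable borel" by auto
  define c where "c = (LINT a|lborel. indicator {0<..<r} a * w a)"
  define B where "B = (LINT a|lborel. \<bar>w a\<bar>)"
  have iw: "integrable lborel (\<lambda>a. indicator {0<..<r} a * w a)"
    by (rule Bochner_Integration.integrable_bound[OF w]) (auto simp: indicator_def)
  have wpos: "w a > 0" if "0 < a" "a < 2 * r" for a
    using r(2)[OF that] that by (simp add: w_def)
  have le: "c \<le> (1/2) ^ j * B" if "(LINT a|lborel. indicator {0<..} a * (h a / a ^ Suc (N + j))) = 0" for j
  proof -
    have eq: "(r / a) ^ j * w a = r ^ j * (indicator {0<..} a * (h a / a ^ Suc (N + j)))" for a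
      by (simp add: w_def power_divide power_add)
    have i2: "integrable lborel (\<lambda>a. (r / a) ^ j * w a)"
      unfolding eq by (intro integrable_mult_right ints) auto
    have "c - (1/2) ^ j * B = (LINT a|lborel. indicator {0<..<r} a * w a - (1/2) ^ j * \<bar>w a\<bar>)"
      unfolding c_def B_def using iw w by (subst Bochner_Integration.integral_diff) auto
    also have "\<dots> \<le> (LINT a|lborel. (r / a) ^ j * w a)"
    proof (rule integral_mono)
      fix a :: real
      have nn: "0 \<le> (1/2) ^ j * \<bar>w a\<bar>" by simp
      consider "a \<le> 0" | "0 < a" "a < r" | "r \<le> a" "a < 2 * r" | "2 * r \<le> a" by linarith
      then show "indicator {0<..<r} a * w a - (1/2) ^ j * \<bar>w a\<bar> \<le> (r / a) ^ j * w a"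
      proof cases
        case 1
        then show ?thesis by (simp add: w_def)
      next
        case 2
        then have "1 \<le> (r / a) ^ j" by (intro one_le_power) auto
        then have "1 * w a \<le> (r / a) ^ j * w a" using wpos[of a] 2 by (intro mult_right_mono) auto
        moreover have "indicator {0<..<r} a * w a = w a" using 2 by simp
        ultimately show ?thesis using nn by linarith
      next
        case 3
        then have "0 \<le> (r / a) ^ j * w a" using wpos[of a] r(1) by auto
        moreover have "indicator {0<..<r} a * w a = 0" using 3 by simp
        ultimately show ?thesis using nn by linarith
      next
        case 4
        then have "(r / a) ^ j \<le> (1 / 2) ^ j" using r(1) by (intro power_mono) (auto simp: field_simps)
        then have "(r / a) ^ j * \<bar>w a\<bar> \<le> (1 / 2) ^ j * \<bar>w a\<bar>" by (intro mult_right_mono) auto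
        moreover have "- ((r / a) ^ j * w a) \<le> (r / a) ^ j * \<bar>w a\<bar>"
          using 4 r(1) by (subst mult_minus_right[symmetric], intro mult_left_mono) auto
        moreover have "indicator {0<..<r} a * w a = 0" using 4 r(1) by simp
        ultimately show ?thesis by linarith
      qed
    qed (use iw w i2 in auto)
    also have "\<dots> = 0" unfolding eq integral_mult_right_zero using that by simp
    finally show ?thesis by simp
  qed
  have "\<exists>\<^sub>\<infinity>j. (LINT a|lborel. indicator {0<..} a * (h a / a ^ Suc (N + j))) = 0"
    unfolding INFM_nat_le
  proof
    fix m
    obtain k where "k \<ge> m + N" "(LINT a|lborel. indicator {0<..} a * (h a / a ^ Suc k)) = 0"
      using zero unfolding INFM_nat_le by blast
    then show "\<exists>j\<ge>m. (LINT a|lborel. indicator {0<..} a * (h a / a ^ Suc (N + j))) = 0"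
      by (intro exI[of _ "k - N"]) auto
  qed
  then have freq: "\<exists>\<^sub>F j in sequentially. c \<le> (1/2) ^ j * B"
    unfolding cofinite_eq_sequentially[symmetric] by (rule INFM_mono) (rule le)
  have "c \<le> 0"
  proof (rule ccontr)
    assume "\<not> c \<le> 0"
    moreover have "(\<lambda>j. (1/2::real) ^ j * B) \<longlonglongrightarrow> 0 * B" by (intro tendsto_intros LIMSEQ_realpow_zero) auto
    ultimately have "\<forall>\<^sub>F j in sequentially. (1/2) ^ j * B < c"
      by (intro order_tendstoD) auto
    then have "\<forall>\<^sub>F j in sequentially. \<not> c \<le> (1/2) ^ j * B"
      by (rule eventually_mono) simp
    then show False using freq unfolding frequently_def by blast
  qed
  moreover have "c \<ge> 0" unfolding c_def
    using wpos r(1) by (intro integral_nonneg_AE AE_I2) (auto simp: indicator_def intro!: less_imp_le)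
  ultimately have "c = 0" by simp
  moreover have "AE a in lborel. 0 \<le> indicator {0<..<r} a * w a"
    using wpos r(1) by (intro AE_I2) (auto simp: indicator_def intro!: less_imp_le)
  ultimately have "AE a in lborel. indicator {0<..<r} a * w a = 0"
    unfolding c_def using integral_nonneg_eq_0_iff_AE[OF iw] by simp
  then have "AE a in lborel. a \<notin> {0<..<r}"
  proof eventually_elim
    case (elim a)
    then show ?case using wpos[of a] r(1) by (cases "a \<in> {0<..<r}") auto
  qed
  then have "{0<..<r} \<in> null_sets lborel"
    by (subst AE_iff_null_sets) auto
  then show False using r(1) by (auto simp: null_sets_def)
qed

text \<open>The hypothesis on \<open>g\<close> expresses flatness at 0 together with polynomial growth at
  infinity; being an integrability condition, it is insensitive to null sets.\<close>

lemma dilation_average_not_eventually_positive: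
  fixes g q :: "real \<Rightarrow> real"
  assumes "g \<in> borel_measurable borel" "q \<in> borel_measurable borel"
    and g: "\<And>k. k \<ge> N \<Longrightarrow> integrable lborel (\<lambda>t. g t / \<bar>t\<bar> ^ Suc k)"
    and q: "\<And>k. integrable lborel (\<lambda>y. y ^ k * q y)"
    and zero: "\<exists>\<^sub>\<infinity>k. (LINT y|lborel. indicator {0<..} y * (y ^ k * q y)) = 0 \<and>
      (LINT y|lborel. indicator {..<0} y * (y ^ k * q y)) = 0"
  shows "\<not> (\<forall>\<^sub>F a in at_right 0. (LINT y|lborel. g (a * y) * q y) > 0)"
proof (rule no_positivity_if_mellin_zeros)
  note mellin = mellin_transform_dilation_average[OF assms(1,2) g q]
  show "integrable lborel (\<lambda>a. indicator {0<..} a * ((LINT y|lborel. g (a * y) * q y) / a ^ Suc k))"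
    if "k \<ge> N" for k
    using mellin(1)[OF that] .
  show "\<exists>\<^sub>\<infinity>k. (LINT a|lborel. indicator {0<..} a * ((LINT y|lborel. g (a * y) * q y) / a ^ Suc k)) = 0"
    unfolding INFM_nat_le
  proof
    fix m
    obtain k where "k \<ge> max m N" "(LINT y|lborel. indicator {0<..} y * (y ^ k * q y)) = 0"
      "(LINT y|lborel. indicator {..<0} y * (y ^ k * q y)) = 0"
      using zero unfolding INFM_nat_le by blast
    then show "\<exists>k\<ge>m. (LINT a|lborel. indicator {0<..} a * ((LINT y|lborel. g (a * y) * q y) / a ^ Suc k)) = 0"
      using mellin(2)[of k] by (intro exI[of _ k]) auto
  qed
qed

section \<open>Functions of polynomial growth\<close>

lemma mult_power_divide_power_Suc:
  fixes B w :: real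
  assumes "w \<noteq> 0"
  shows "B * w ^ d / w ^ (d + 1) = B * inverse w"
  using assms by (simp add: field_simps)

text \<open>Fubini's theorem is applied on the Borel product space, so \<open>f\<close> is replaced by a Borel
  function that agrees with it almost everywhere; the pairing cannot distinguish the two.\<close>

lemma tempered_borel_representative:
  assumes loc: "locally_integrable f" and growth: "polynomial_growth f"
  shows "f \<in> borel_measurable lebesgue"
    and "\<exists>f' M. f' \<in> borel_measurable borel \<and> (AE x in lborel. f x = f' x) \<and>
      integrable lborel (\<lambda>x. f' x / (1 + x\<^sup>2) ^ M)"
proof -
  have int: "integrable lebesgue (\<lambda>x. indicator {-r..r} x *\<^sub>R f x)" for r
    using loc unfolding locally_integrable_def set_integrable_def by auto
  show meas: "f \<in> borel_measurable lebesgue"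
  proof (rule borel_measurable_LIMSEQ_real)
    show "(\<lambda>x. indicator {- real n..real n} x *\<^sub>R f x) \<in> borel_measurable lebesgue" for n
      using int[of "real n"] by (rule borel_measurable_integrable)
    fix x
    obtain n0 where "\<bar>x\<bar> \<le> real n0" using real_arch_simple by blast
    then have "\<forall>\<^sub>F n in sequentially. indicator {- real n..real n} x *\<^sub>R f x = f x"
      by (intro eventually_sequentiallyI[of n0]) (auto simp: indicator_def)
    then show "(\<lambda>n. indicator {- real n..real n} x *\<^sub>R f x) \<longlonglongrightarrow> f x"
      by (rule tendsto_eventually)
  qed
  obtain f' where f': "f' \<in> borel_measurable borel" "AE x in lborel. f x = f' x"
    using completion_ex_borel_measurable_real[OF meas] by auto
  note [measurable] = f'(1)
  obtain N where "f \<in> O[at_infinity](\<lambda>x. \<bar>x\<bar> ^ N)"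
    using growth unfolding polynomial_growth_def by blast
  then obtain C where "\<forall>\<^sub>F x in at_infinity. norm (f x) \<le> C * norm (\<bar>x\<bar> ^ N)"
    by (rule landau_o.bigE)
  then obtain r where r: "\<And>x. \<bar>x\<bar> \<ge> r \<Longrightarrow> \<bar>f x\<bar> \<le> C * \<bar>x\<bar> ^ N"
    by (auto simp: eventually_at_infinity)
  have weight: "integrable lebesgue (\<lambda>x. C * inverse (1 + x\<^sup>2))"
    using integrable_inverse_one_plus_square by (subst integrable_completion) auto
  have "integrable lebesgue (\<lambda>x. f x / (1 + x\<^sup>2) ^ (N + 1))"
  proof (rule Bochner_Integration.integrable_bound)
    show "integrable lebesgue (\<lambda>x. norm (indicator {-r..r} x *\<^sub>R f x) + norm (C * inverse (1 + x\<^sup>2)))"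
      by (intro Bochner_Integration.integrable_add integrable_norm int weight)
    show "AE x in lebesgue. norm (f x / (1 + x\<^sup>2) ^ (N + 1)) \<le>
        norm (norm (indicator {-r..r} x *\<^sub>R f x) + norm (C * inverse (1 + x\<^sup>2)))"
    proof (rule AE_I2)
      fix x :: real
      have pos: "1 + x\<^sup>2 > 0" by (simp add: add_pos_nonneg)
      have one: "1 \<le> (1 + x\<^sup>2) ^ (N + 1)" by (intro one_le_power) simp
      show "norm (f x / (1 + x\<^sup>2) ^ (N + 1)) \<le>
          norm (norm (indicator {-r..r} x *\<^sub>R f x) + norm (C * inverse (1 + x\<^sup>2)))"
      proof (cases "\<bar>x\<bar> \<le> r")
        case True
        have "\<bar>f x\<bar> / (1 + x\<^sup>2) ^ (N + 1) \<le> \<bar>f x\<bar> / 1"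
          using one by (intro divide_left_mono) auto
        moreover have "indicator {-r..r} x = (1::real)" using True by (auto simp: indicator_def)
        ultimately have "norm (f x / (1 + x\<^sup>2) ^ (N + 1)) \<le> norm (indicator {-r..r} x *\<^sub>R f x)"
          using pos by (simp add: abs_divide del: power_Suc)
        then show ?thesis by (smt (verit) norm_ge_zero real_norm_def)
      next
        case False
        have "\<bar>f x\<bar> \<le> C * \<bar>x\<bar> ^ N" using False by (intro r) auto
        also have "\<dots> \<le> \<bar>C\<bar> * \<bar>x\<bar> ^ N" by (intro mult_right_mono) auto
        also have "\<dots> \<le> \<bar>C\<bar> * (1 + x\<^sup>2) ^ N"
          by (intro mult_left_mono power_mono abs_le_one_plus_square) auto
        finally have "norm (f x / (1 + x\<^sup>2) ^ (N + 1)) \<le> \<bar>C\<bar> * (1 + x\<^sup>2) ^ N / (1 + x\<^sup>2) ^ (N + 1)"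
          using pos by (simp add: abs_divide divide_right_mono del: power_Suc)
        also have "\<dots> = \<bar>C\<bar> * inverse (1 + x\<^sup>2)"
          using pos by (intro mult_power_divide_power_Suc) simp
        also have "\<dots> = norm (C * inverse (1 + x\<^sup>2))"
          using pos by (simp add: abs_mult)
        finally show ?thesis by (smt (verit) norm_ge_zero real_norm_def)
      qed
    qed
  next
    show "(\<lambda>x. f x / (1 + x\<^sup>2) ^ (N + 1)) \<in> borel_measurable lebesgue"
      by (rule borel_measurable_divide[OF meas measurable_completion]) measurable
  qed
  then have "integrable lebesgue (\<lambda>x. f' x / (1 + x\<^sup>2) ^ (N + 1))"
  proof (rule integrable_cong_AE_imp)
    show "AE x in lebesgue. f x / (1 + x\<^sup>2) ^ (N + 1) = f' x / (1 + x\<^sup>2) ^ (N + 1)"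
      using AE_completion[OF f'(2)] by eventually_elim simp
    show "(\<lambda>x. f' x / (1 + x\<^sup>2) ^ (N + 1)) \<in> borel_measurable lebesgue"
      by (rule measurable_completion) measurable
  qed
  then have "integrable lborel (\<lambda>x. f' x / (1 + x\<^sup>2) ^ (N + 1))"
    by (subst (asm) integrable_completion) auto
  then show "\<exists>f' M. f' \<in> borel_measurable borel \<and> (AE x in lborel. f x = f' x) \<and>
      integrable lborel (\<lambda>x. f' x / (1 + x\<^sup>2) ^ M)"
    using f' by blast
qed

lemma distr_of_eq_lborel:
  assumes "f \<in> borel_measurable lebesgue" and [measurable]: "f' \<in> borel_measurable borel" "\<phi> \<in> borel_measurable borel"
    and eq: "AE x in lborel. f x = f' x"
  shows "distr_of f \<phi> = (LINT x|lborel. of_real (f' x) * \<phi> x)"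
proof -
  have "distr_of f \<phi> = (LINT x|lebesgue. of_real (f' x) * \<phi> x)"
    unfolding distr_of_def
  proof (rule integral_cong_AE)
    show "AE x in lebesgue. of_real (f x) * \<phi> x = of_real (f' x) * \<phi> x"
      using AE_completion[OF eq] by eventually_elim simp
    show "(\<lambda>x. of_real (f x) * \<phi> x) \<in> borel_measurable lebesgue"
      by (rule borel_measurable_times[OF measurable_compose[OF assms(1) borel_measurable_of_real] measurable_completion]) simp
    show "(\<lambda>x. complex_of_real (f' x) * \<phi> x) \<in> borel_measurable lebesgue"
      by (rule measurable_completion) measurable
  qed
  also have "\<dots> = (LINT x|lborel. of_real (f' x) * \<phi> x)"
    by (subst integral_completion) auto
  finally show ?thesis .
qed

lemma one_plus_square_affine_le:
  fixes a b y :: real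
  shows "1 + (b + a * y)\<^sup>2 \<le> (1 + 2 * b\<^sup>2 + 2 * a\<^sup>2) * (1 + y\<^sup>2)"
proof -
  have "(b + a * y)\<^sup>2 \<le> 2 * b\<^sup>2 + 2 * (a * y)\<^sup>2"
    using zero_le_power2[of "b - a * y"] by (simp add: power2_eq_square algebra_simps)
  moreover have "0 \<le> y\<^sup>2 + 2 * (b\<^sup>2 * y\<^sup>2) + 2 * a\<^sup>2" by simp
  moreover have "(1 + 2 * b\<^sup>2 + 2 * a\<^sup>2) * (1 + y\<^sup>2) =
      1 + (2 * b\<^sup>2 + 2 * (a * y)\<^sup>2) + (y\<^sup>2 + 2 * (b\<^sup>2 * y\<^sup>2) + 2 * a\<^sup>2)"
    by (simp add: algebra_simps power_mult_distrib)
  ultimately show ?thesis by linarith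
qed

lemma dilate_translate_borel_measurable:
  assumes "\<kappa> \<in> borel_measurable borel"
  shows "dilate_translate \<kappa> a b \<in> borel_measurable borel"
  using assms unfolding dilate_translate_def[abs_def] by measurable

lemma tempered_dilate_integrable:
  assumes s: "schwartz \<kappa>" and a: "a > 0"
    and [measurable]: "f \<in> borel_measurable borel" and f: "integrable lborel (\<lambda>x. f x / (1 + x\<^sup>2) ^ M)"
  shows "integrable lborel (\<lambda>x. complex_of_real (f x) * dilate_translate \<kappa> a b x)"
proof -
  have [measurable]: "\<kappa> \<in> borel_measurable borel" by (rule schwartz_borel_measurable[OF s])
  note [measurable] = dilate_translate_borel_measurable[of \<kappa>]
  obtain C where C: "\<And>x. (1 + x\<^sup>2) ^ M * norm (\<kappa> x) \<le> C"
    using schwartz_weighted_bound[OF s] by blast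
  define K where "K = 1 + 2 * b\<^sup>2 + 2 * a\<^sup>2"
  have K: "K > 0" by (simp add: K_def add_pos_nonneg)
  have bound: "(1 + x\<^sup>2) ^ M * norm (dilate_translate \<kappa> a b x) \<le> 1 / sqrt a * K ^ M * C" for x
  proof -
    define y where "y = (x - b) / a"
    have x: "x = b + a * y" using a by (simp add: y_def)
    have "(1 + x\<^sup>2) ^ M \<le> (K * (1 + y\<^sup>2)) ^ M"
      unfolding x K_def by (intro power_mono one_plus_square_affine_le) auto
    then have "(1 + x\<^sup>2) ^ M * norm (\<kappa> y) \<le> (K * (1 + y\<^sup>2)) ^ M * norm (\<kappa> y)"
      by (intro mult_right_mono) auto
    also have "\<dots> = K ^ M * ((1 + y\<^sup>2) ^ M * norm (\<kappa> y))" by (simp add: power_mult_distrib)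
    also have "\<dots> \<le> K ^ M * C" using K by (intro mult_left_mono C) auto
    finally have "1 / sqrt a * ((1 + x\<^sup>2) ^ M * norm (\<kappa> y)) \<le> 1 / sqrt a * (K ^ M * C)"
      using a by (intro mult_left_mono) auto
    then show ?thesis
      using a by (simp add: dilate_translate_def y_def norm_mult norm_divide mult_ac)
  qed
  show ?thesis
  proof (rule Bochner_Integration.integrable_bound)
    show "integrable lborel (\<lambda>x. (1 / sqrt a * K ^ M * C) * (f x / (1 + x\<^sup>2) ^ M))"
      using f by (rule integrable_mult_right)
    show "AE x in lborel. norm (complex_of_real (f x) * dilate_translate \<kappa> a b x) \<le>
        norm ((1 / sqrt a * K ^ M * C) * (f x / (1 + x\<^sup>2) ^ M))"
    proof (rule AE_I2)
      fix x :: real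
      have pos: "(1 + x\<^sup>2) ^ M > 0" by (simp add: add_pos_nonneg)
      have "\<bar>f x\<bar> * norm (dilate_translate \<kappa> a b x) =
          \<bar>f x\<bar> / (1 + x\<^sup>2) ^ M * ((1 + x\<^sup>2) ^ M * norm (dilate_translate \<kappa> a b x))"
        using pos by (simp del: power_eq_0_iff)
      also have "\<dots> \<le> \<bar>f x\<bar> / (1 + x\<^sup>2) ^ M * \<bar>1 / sqrt a * K ^ M * C\<bar>"
        using pos order_trans[OF bound[of x] abs_ge_self] by (intro mult_left_mono) simp_all
      also have "\<dots> = norm ((1 / sqrt a * K ^ M * C) * (f x / (1 + x\<^sup>2) ^ M))"
        using pos by (simp add: abs_mult abs_divide mult_ac)
      finally show "norm (complex_of_real (f x) * dilate_translate \<kappa> a b x) \<le>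
          norm ((1 / sqrt a * K ^ M * C) * (f x / (1 + x\<^sup>2) ^ M))"
        by (simp add: norm_mult)
    qed
  qed measurable
qed

lemma borel_measurable_poly [measurable]:
  fixes p :: "real poly"
  shows "poly p \<in> borel_measurable borel"
  by (intro borel_measurable_continuous_onI continuous_intros)

lemma poly_tempered:
  fixes p :: "real poly"
  shows "integrable lborel (\<lambda>x. poly p x / (1 + x\<^sup>2) ^ (degree p + 1))"
proof -
  define B where "B = (\<Sum>i\<le>degree p. \<bar>coeff p i\<bar>)"
  have bound: "\<bar>poly p x\<bar> \<le> B * (1 + x\<^sup>2) ^ degree p" for x
  proof -
    have "\<bar>poly p x\<bar> \<le> (\<Sum>i\<le>degree p. \<bar>coeff p i * x ^ i\<bar>)" unfolding poly_altdef by (rule sum_abs)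
    also have "\<dots> \<le> (\<Sum>i\<le>degree p. \<bar>coeff p i\<bar> * (1 + x\<^sup>2) ^ degree p)"
    proof (rule sum_mono)
      fix i assume i: "i \<in> {..degree p}"
      have "\<bar>x\<bar> ^ i \<le> (1 + x\<^sup>2) ^ i" by (intro power_mono abs_le_one_plus_square) auto
      also have "\<dots> \<le> (1 + x\<^sup>2) ^ degree p" using i by (intro power_increasing) auto
      finally show "\<bar>coeff p i * x ^ i\<bar> \<le> \<bar>coeff p i\<bar> * (1 + x\<^sup>2) ^ degree p"
        by (simp add: abs_mult power_abs mult_left_mono)
    qed
    finally show ?thesis by (simp add: B_def sum_distrib_right)
  qed
  show ?thesis
  proof (rule Bochner_Integration.integrable_bound)
    show "integrable lborel (\<lambda>x. B * inverse (1 + x\<^sup>2))"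
      using integrable_inverse_one_plus_square by auto
    show "AE x in lborel. norm (poly p x / (1 + x\<^sup>2) ^ (degree p + 1)) \<le> norm (B * inverse (1 + x\<^sup>2))"
    proof (rule AE_I2)
      fix x :: real
      have pos: "1 + x\<^sup>2 > 0" by (simp add: add_pos_nonneg)
      have "\<bar>poly p x\<bar> / (1 + x\<^sup>2) ^ (degree p + 1) \<le> B * (1 + x\<^sup>2) ^ degree p / (1 + x\<^sup>2) ^ (degree p + 1)"
        using pos bound[of x] by (intro divide_right_mono) auto
      also have "\<dots> = B * inverse (1 + x\<^sup>2)" using pos by (intro mult_power_divide_power_Suc) simp
      finally show "norm (poly p x / (1 + x\<^sup>2) ^ (degree p + 1)) \<le> norm (B * inverse (1 + x\<^sup>2))"
        using pos by (simp add: abs_divide del: power_Suc)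
    qed
  qed (auto simp: poly_altdef)
qed

lemma tempered_mono:
  assumes [measurable]: "f \<in> borel_measurable borel" and f: "integrable lborel (\<lambda>x::real. f x / (1 + x\<^sup>2) ^ M)" and le: "M \<le> M'"
  shows "integrable lborel (\<lambda>x. (f x :: real) / (1 + x\<^sup>2) ^ M')"
proof (rule Bochner_Integration.integrable_bound[OF f])
  show "AE x in lborel. norm (f x / (1 + x\<^sup>2) ^ M') \<le> norm (f x / (1 + x\<^sup>2) ^ M)"
  proof (rule AE_I2)
    fix x :: real
    have "(1 + x\<^sup>2) ^ M > 0" "(1 + x\<^sup>2) ^ M \<le> (1 + x\<^sup>2) ^ M'" using le by (auto simp: add_pos_nonneg intro!: power_increasing)
    then show "norm (f x / (1 + x\<^sup>2) ^ M') \<le> norm (f x / (1 + x\<^sup>2) ^ M)"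
      by (auto simp: abs_divide intro!: divide_left_mono)
  qed
qed measurable

text \<open>Near 0 flatness bounds the quotient; away from 0 the power \<open>\<bar>t\<bar> ^ n\<close>
  dominates the weight.\<close>

lemma tempered_flat_quotient_integrable:
  fixes g :: "real \<Rightarrow> real"
  assumes [measurable]: "g \<in> borel_measurable borel"
    and g: "integrable lborel (\<lambda>t. g t / (1 + (b + t)\<^sup>2) ^ M)"
    and flat: "\<delta> > 0" "AE t in lborel. \<bar>t\<bar> < \<delta> \<longrightarrow> \<bar>g t\<bar> \<le> C * \<bar>t\<bar> ^ n"
    and n: "n \<ge> 2 * M"
  shows "integrable lborel (\<lambda>t. g t / \<bar>t\<bar> ^ n)"
proof (rule Bochner_Integration.integrable_bound)
  \<comment> \<open>\<open>K\<close> and \<open>C'\<close> compare the weight with \<open>\<bar>t\<bar> ^ n\<close> away from 0, where \<open>\<bar>t\<bar> \<ge> \<delta>\<close>.\<close>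
  define K where "K = (1 + 2 * b\<^sup>2 + 2) * (1 / \<delta>\<^sup>2 + 1)"
  have K: "K > 0" unfolding K_def using flat(1) by (intro mult_pos_pos) (auto simp: add_nonneg_pos add_pos_nonneg)
  define C' where "C' = K ^ M / \<delta> ^ (n - 2 * M)"
  have C': "C' > 0" using K flat(1) by (simp add: C'_def)
  show "integrable lborel (\<lambda>t. \<bar>C\<bar> * indicator {-\<delta><..<\<delta>} t + C' * norm (g t / (1 + (b + t)\<^sup>2) ^ M))"
    by (intro Bochner_Integration.integrable_add integrable_mult_right integrable_norm g)
      (auto intro!: integrable_real_indicator simp: flat(1) less_imp_le)
  show "AE t in lborel. norm (g t / \<bar>t\<bar> ^ n) \<le>
      norm (\<bar>C\<bar> * indicator {-\<delta><..<\<delta>} t + C' * norm (g t / (1 + (b + t)\<^sup>2) ^ M))"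
    using flat(2)
  proof eventually_elim
    case (elim t)
    have w: "(1 + (b + t)\<^sup>2) ^ M > 0" by (simp add: add_pos_nonneg)
    have "norm (g t / \<bar>t\<bar> ^ n) \<le> \<bar>C\<bar> * indicator {-\<delta><..<\<delta>} t + C' * norm (g t / (1 + (b + t)\<^sup>2) ^ M)"
    proof (cases "\<bar>t\<bar> < \<delta>")
      case True
      have "\<bar>g t\<bar> / \<bar>t\<bar> ^ n \<le> \<bar>C\<bar>"
      proof (cases "\<bar>t\<bar> ^ n = 0")
        case False
        have "\<bar>g t\<bar> \<le> C * \<bar>t\<bar> ^ n" using elim True by simp
        also have "\<dots> \<le> \<bar>C\<bar> * \<bar>t\<bar> ^ n" by (intro mult_right_mono) auto
        finally have "\<bar>g t\<bar> \<le> \<bar>C\<bar> * \<bar>t\<bar> ^ n" .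
        moreover have "\<bar>t\<bar> ^ n > 0" using False by (metis abs_ge_zero less_eq_real_def zero_le_power)
        ultimately show ?thesis by (simp add: pos_divide_le_eq)
      next
        case True
        then show ?thesis by (simp only: div_by_0 abs_ge_zero)
      qed
      moreover have "0 \<le> C' * norm (g t / (1 + (b + t)\<^sup>2) ^ M)" using C' by simp
      moreover have "indicator {-\<delta><..<\<delta>} t = (1::real)" using True by (auto simp: indicator_def)
      ultimately show ?thesis by (simp add: abs_divide)
    next
      case False
      then have t: "\<bar>t\<bar> \<ge> \<delta>" "t \<noteq> 0" using flat(1) by auto
      have "\<delta>\<^sup>2 \<le> t\<^sup>2" using t(1) flat(1) by (metis less_eq_real_def power2_abs power_mono)
      then have "1 + t\<^sup>2 \<le> (1 / \<delta>\<^sup>2 + 1) * t\<^sup>2" using flat(1) by (simp add: field_simps)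
      then have "(1 + 2 * b\<^sup>2 + 2) * (1 + t\<^sup>2) \<le> (1 + 2 * b\<^sup>2 + 2) * ((1 / \<delta>\<^sup>2 + 1) * t\<^sup>2)"
        by (intro mult_left_mono) auto
      with one_plus_square_affine_le[of b 1 t] have "1 + (b + t)\<^sup>2 \<le> K * t\<^sup>2" by (simp add: K_def mult.assoc)
      then have "(1 + (b + t)\<^sup>2) ^ M \<le> (K * t\<^sup>2) ^ M" by (intro power_mono) auto
      also have "\<dots> = K ^ M * \<bar>t\<bar> ^ (2 * M)" by (simp add: power_mult_distrib power_mult)
      finally have "(1 + (b + t)\<^sup>2) ^ M * \<delta> ^ (n - 2 * M) \<le> K ^ M * \<bar>t\<bar> ^ (2 * M) * \<bar>t\<bar> ^ (n - 2 * M)"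
        using t(1) flat(1) w K by (intro mult_mono power_mono) auto
      also have "\<dots> = K ^ M * \<bar>t\<bar> ^ n" using n by (simp add: mult.assoc flip: power_add)
      finally have "1 / \<bar>t\<bar> ^ n \<le> C' / (1 + (b + t)\<^sup>2) ^ M"
        using w t(2) flat(1) by (simp add: C'_def field_simps)
      then have "\<bar>g t\<bar> * (1 / \<bar>t\<bar> ^ n) \<le> \<bar>g t\<bar> * (C' / (1 + (b + t)\<^sup>2) ^ M)" by (intro mult_left_mono) auto
      moreover have "indicator {-\<delta><..<\<delta>} t = (0::real)" using False by (auto simp: indicator_def)
      ultimately show ?thesis using w by (simp add: abs_divide mult.commute)
    qed
    then show ?case by (rule order_trans) (simp only: real_norm_def abs_ge_self)
  qed
qed measurable

section \<open>The signature at a point of flatness\<close>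

text \<open>All moments of \<open>\<kappa>\<close> vanish, so the pairing does not see polynomials.\<close>

lemma dilated_poly_integral_zero:
  fixes p :: "real poly"
  assumes w: "signature_wavelet \<kappa>" and a: "a > 0"
  shows "(LINT x|lborel. complex_of_real (poly p (x - b)) * dilate_translate \<kappa> a b x) = 0"
proof -
  have s: "schwartz \<kappa>" using w by (simp add: signature_wavelet_def)
  have "(LINT x|lborel. complex_of_real (poly p (x - b)) * dilate_translate \<kappa> a b x) =
      a *\<^sub>R (LINT y|lborel. complex_of_real (poly p (a * y)) * (complex_of_real (1 / sqrt a) * \<kappa> y))"
    using a by (subst lborel_integral_real_affine[of a _ b]) (auto simp: dilate_translate_def)
  also have "(LINT y|lborel. complex_of_real (poly p (a * y)) * (complex_of_real (1 / sqrt a) * \<kappa> y)) =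
      (LINT y|lborel. (\<Sum>i\<le>degree p. complex_of_real (coeff p i * a ^ i / sqrt a) * (complex_of_real (y ^ i) * \<kappa> y)))"
    by (intro Bochner_Integration.integral_cong refl)
      (simp add: poly_altdef sum_distrib_right sum_distrib_left power_mult_distrib mult_ac sum_divide_distrib)
  also have "\<dots> = (\<Sum>i\<le>degree p. complex_of_real (coeff p i * a ^ i / sqrt a) * (LINT y|lborel. complex_of_real (y ^ i) * \<kappa> y))"
    by (simp add: Bochner_Integration.integral_sum schwartz_moment_integrable[OF s] del: of_real_power)
  also have "\<dots> = 0" by (simp add: signature_wavelet_moment_zero[OF w] del: of_real_power)
  finally show ?thesis by simp
qed

text \<open>The substitution \<open>x = b + a y\<close>, after subtracting a polynomial that does not
  change the pairing.\<close>

lemma distr_of_dilate: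
  fixes b :: real and p :: "real poly"
  assumes w: "signature_wavelet \<kappa>" and a: "a > 0"
    and f: "f \<in> borel_measurable lebesgue" "f' \<in> borel_measurable borel" "AE x in lborel. f x = f' x"
      "integrable lborel (\<lambda>x. f' x / (1 + x\<^sup>2) ^ M)"
  defines "g \<equiv> \<lambda>t. f' (b + t) - poly p t"
  shows "Re (distr_of f (dilate_translate \<kappa> a b)) = sqrt a * (LINT y|lborel. g (a * y) * Re (\<kappa> y))"
    and "Im (distr_of f (dilate_translate \<kappa> a b)) = sqrt a * (LINT y|lborel. g (a * y) * Im (\<kappa> y))"
proof -
  have s: "schwartz \<kappa>" using w by (simp add: signature_wavelet_def)
  note [measurable] = f(2) schwartz_borel_measurable[OF s]
  let ?D = "dilate_translate \<kappa> a b"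
  have [measurable]: "?D \<in> borel_measurable borel" by (rule dilate_translate_borel_measurable) measurable
  define P where "P x = poly p (x - b)" for x
  have P: "P = poly (pcompose p [:- b, 1:])" by (auto simp: P_def poly_pcompose)
  have [measurable]: "P \<in> borel_measurable borel" unfolding P by measurable
  have iP: "integrable lborel (\<lambda>x. complex_of_real (P x) * ?D x)"
    using tempered_dilate_integrable[OF s a _ poly_tempered] unfolding P by (auto simp: poly_altdef)
  have if': "integrable lborel (\<lambda>x. complex_of_real (f' x) * ?D x)"
    by (rule tempered_dilate_integrable[OF s a f(2,4)])
  have ig: "integrable lborel (\<lambda>x. complex_of_real (f' x - P x) * ?D x)"
    using if' iP by (simp add: left_diff_distrib)
  have "distr_of f ?D = (LINT x|lborel. complex_of_real (f' x) * ?D x)"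
    using f(1-3) by (intro distr_of_eq_lborel) auto
  also have "\<dots> = (LINT x|lborel. complex_of_real (f' x) * ?D x) - (LINT x|lborel. complex_of_real (P x) * ?D x)"
    unfolding P_def by (simp only: dilated_poly_integral_zero[OF w a] diff_zero)
  also have "\<dots> = (LINT x|lborel. complex_of_real (f' x - P x) * ?D x)"
    using if' iP by (simp add: left_diff_distrib)
  also have "\<dots> = a *\<^sub>R (LINT y|lborel. complex_of_real (f' (b + a * y) - P (b + a * y)) * ?D (b + a * y))"
    using a by (subst lborel_integral_real_affine[of a _ b]) auto
  also have "\<dots> = a *\<^sub>R (LINT y|lborel. complex_of_real (1 / sqrt a) * (complex_of_real (g (a * y)) * \<kappa> y))"
    using a by (simp add: g_def P_def dilate_translate_def mult_ac)
  also have "\<dots> = complex_of_real (sqrt a) * (LINT y|lborel. complex_of_real (g (a * y)) * \<kappa> y)"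
    using a by (simp only: integral_mult_right_zero) (simp add: scaleR_conv_of_real real_div_sqrt flip: of_real_divide mult.assoc of_real_mult)
  finally have eq: "distr_of f ?D = complex_of_real (sqrt a) * (LINT y|lborel. complex_of_real (g (a * y)) * \<kappa> y)" .
  have "integrable lborel (\<lambda>y. complex_of_real (sqrt a) * (complex_of_real (f' (b + a * y) - P (b + a * y)) * ?D (b + a * y)))"
    using a by (intro integrable_mult_right lborel_integrable_real_affine[OF ig]) auto
  then have int: "integrable lborel (\<lambda>y. complex_of_real (g (a * y)) * \<kappa> y)"
    using a by (simp add: g_def P_def dilate_translate_def)
  show "Re (distr_of f ?D) = sqrt a * (LINT y|lborel. g (a * y) * Re (\<kappa> y))"
    unfolding eq using integral_Re[OF int] by simp
  show "Im (distr_of f ?D) = sqrt a * (LINT y|lborel. g (a * y) * Im (\<kappa> y))"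
    unfolding eq using integral_Im[OF int] by simp
qed

text \<open>A limit of signs is either 0 or has a real or imaginary part of a definite sign, which the pairing
  then shares for all small scales.\<close>

lemma signature_zero_if_no_sign:
  assumes "\<not> (\<forall>\<^sub>F a in at_right 0. Re (T (dilate_translate \<kappa> a b)) > 0)"
    and "\<not> (\<forall>\<^sub>F a in at_right 0. Re (T (dilate_translate \<kappa> a b)) < 0)"
    and "\<not> (\<forall>\<^sub>F a in at_right 0. Im (T (dilate_translate \<kappa> a b)) > 0)"
    and "\<not> (\<forall>\<^sub>F a in at_right 0. Im (T (dilate_translate \<kappa> a b)) < 0)"
  shows "signature \<kappa> T b = 0"
proof (rule ccontr)
  define s where "s a = sgn (T (dilate_translate \<kappa> a b))" for a
  assume nz: "signature \<kappa> T b \<noteq> 0"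
  then have "\<exists>l. (s \<longlongrightarrow> l) (at_right 0)"
    by (auto simp: signature_def s_def[abs_def] Let_def split: if_splits)
  then obtain l where l: "(s \<longlongrightarrow> l) (at_right 0)" by blast
  then have "signature \<kappa> T b = l"
    using tendsto_Lim[OF _ l] by (auto simp: signature_def s_def[abs_def] Let_def)
  with nz have "l \<noteq> 0" by simp
  then consider "Re l > 0" | "Re l < 0" | "Im l > 0" | "Im l < 0"
    by (auto simp: complex_eq_iff linorder_neq_iff)
  then show False
  proof cases
    case 1
    then have "\<forall>\<^sub>F a in at_right 0. Re (s a) > 0" by (rule order_tendstoD(1)[OF tendsto_Re[OF l]])
    then have "\<forall>\<^sub>F a in at_right 0. Re (T (dilate_translate \<kappa> a b)) > 0"
      by (rule eventually_mono) (simp add: s_def sgn_eq zero_less_divide_iff)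
    with assms(1) show ?thesis by blast
  next
    case 2
    then have "\<forall>\<^sub>F a in at_right 0. Re (s a) < 0" by (rule order_tendstoD(2)[OF tendsto_Re[OF l]])
    then have "\<forall>\<^sub>F a in at_right 0. Re (T (dilate_translate \<kappa> a b)) < 0"
      by (rule eventually_mono) (simp add: s_def sgn_eq divide_less_0_iff)
    with assms(2) show ?thesis by blast
  next
    case 3
    then have "\<forall>\<^sub>F a in at_right 0. Im (s a) > 0" by (rule order_tendstoD(1)[OF tendsto_Im[OF l]])
    then have "\<forall>\<^sub>F a in at_right 0. Im (T (dilate_translate \<kappa> a b)) > 0"
      by (rule eventually_mono) (simp add: s_def sgn_eq zero_less_divide_iff)
    with assms(3) show ?thesis by blast
  next
    case 4
    then have "\<forall>\<^sub>F a in at_right 0. Im (s a) < 0" by (rule order_tendstoD(2)[OF tendsto_Im[OF l]])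
    then have "\<forall>\<^sub>F a in at_right 0. Im (T (dilate_translate \<kappa> a b)) < 0"
      by (rule eventually_mono) (simp add: s_def sgn_eq divide_less_0_iff)
    with assms(4) show ?thesis by blast
  qed
qed

text \<open>All parts of the theorem reduce to this statement. The flatness may hold only almost everywhere,
  so it also covers functions that vanish as distributions near \<open>b\<close>.\<close>

lemma signature_zero_if_flat:
  fixes f :: "real \<Rightarrow> real"
  assumes w: "signature_wavelet \<kappa>"
    and loc: "locally_integrable f" and growth: "polynomial_growth f"
    and flat: "\<And>n. \<exists>\<delta>>0. \<exists>C. AE x in lborel. \<bar>x - b\<bar> < \<delta> \<longrightarrow> \<bar>f x - poly p (x - b)\<bar> \<le> C * \<bar>x - b\<bar> ^ n"
  shows "signature \<kappa> (distr_of f) b = 0"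
proof -
  have s: "schwartz \<kappa>" using w by (simp add: signature_wavelet_def)
  have f: "f \<in> borel_measurable lebesgue" by (rule tempered_borel_representative[OF loc growth])
  obtain f' M where f': "f' \<in> borel_measurable borel" "AE x in lborel. f x = f' x"
    "integrable lborel (\<lambda>x. f' x / (1 + x\<^sup>2) ^ M)"
    using tempered_borel_representative(2)[OF loc growth] by blast
  note [measurable] = f'(1) schwartz_borel_measurable[OF s]
  define g where "g t = f' (b + t) - poly p t" for t
  have gm: "g \<in> borel_measurable borel" unfolding g_def[abs_def] by measurable
  \<comment> \<open>\<open>r\<close> is the translated polynomial, and \<open>M'\<close> a weight that tames both \<open>f'\<close> and \<open>r\<close>.\<close>
  define r where "r = pcompose p [:- b, 1:]"
  define M' where "M' = max M (degree r + 1)"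
  have "integrable lborel (\<lambda>x. f' x / (1 + x\<^sup>2) ^ M' - poly r x / (1 + x\<^sup>2) ^ M')"
    using tempered_mono[OF f'(1,3), of M'] tempered_mono[OF borel_measurable_poly poly_tempered, of r M'] by (simp add: M'_def)
  then have "integrable lborel (\<lambda>t. f' (b + 1 * t) / (1 + (b + 1 * t)\<^sup>2) ^ M' - poly r (b + 1 * t) / (1 + (b + 1 * t)\<^sup>2) ^ M')"
    by (rule lborel_integrable_real_affine) simp
  then have gi: "integrable lborel (\<lambda>t. g t / (1 + (b + t)\<^sup>2) ^ M')"
    by (simp add: g_def r_def poly_pcompose diff_divide_distrib)
  have int: "integrable lborel (\<lambda>t. g t / \<bar>t\<bar> ^ Suc k)" if k: "k \<ge> 2 * M'" for k
  proof -
    obtain \<delta> C where \<delta>: "\<delta> > 0" and "AE x in lborel. \<bar>x - b\<bar> < \<delta> \<longrightarrow> \<bar>f x - poly p (x - b)\<bar> \<le> C * \<bar>x - b\<bar> ^ Suc k"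
      using flat by blast
    then have "AE x in lborel. \<bar>x - b\<bar> < \<delta> \<longrightarrow> \<bar>f' x - poly p (x - b)\<bar> \<le> C * \<bar>x - b\<bar> ^ Suc k"
      using f'(2) by (auto elim!: AE_mp)
    then have "AE t in lborel. \<bar>(b + 1 * t) - b\<bar> < \<delta> \<longrightarrow>
        \<bar>f' (b + 1 * t) - poly p ((b + 1 * t) - b)\<bar> \<le> C * \<bar>(b + 1 * t) - b\<bar> ^ Suc k"
      by (intro AE_borel_affine) (simp_all, measurable)
    then have "AE t in lborel. \<bar>t\<bar> < \<delta> \<longrightarrow> \<bar>g t\<bar> \<le> C * \<bar>t\<bar> ^ Suc k"
      by (simp add: g_def)
    then show ?thesis using k by (intro tempered_flat_quotient_integrable[OF gm gi \<delta>]) auto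
  qed
  have mom: "integrable lborel (\<lambda>y. y ^ k * Re (\<kappa> y))" "integrable lborel (\<lambda>y. y ^ k * Im (\<kappa> y))" for k
    using integrable_Re[OF schwartz_moment_integrable[OF s, of k]] integrable_Im[OF schwartz_moment_integrable[OF s, of k]]
    by (simp_all flip: of_real_power)
  note half = signature_wavelet_half_moments[OF w]
  have inf_even: "\<exists>\<^sub>\<infinity>k::nat. even k" unfolding INFM_nat_le by (metis dvd_triv_left le_add1 mult_2)
  have inf_odd: "\<exists>\<^sub>\<infinity>k::nat. odd k" unfolding INFM_nat_le by (metis dvd_triv_left even_Suc le_SucI le_add1 mult_2)
  \<comment> \<open>The factor \<open>c\<close> is used with the values 1 and - 1, to exclude either sign.\<close>
  have re: "\<not> (\<forall>\<^sub>F a in at_right 0. (LINT y|lborel. g (a * y) * (c * Re (\<kappa> y))) > 0)" for c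
  proof (rule dilation_average_not_eventually_positive[OF gm _ int])
    show "integrable lborel (\<lambda>y. y ^ k * (c * Re (\<kappa> y)))" for k
      using integrable_mult_right[OF mom(1), of c k] by (simp add: mult_ac)
    show "\<exists>\<^sub>\<infinity>k. (LINT y|lborel. indicator {0<..} y * (y ^ k * (c * Re (\<kappa> y)))) = 0 \<and>
        (LINT y|lborel. indicator {..<0} y * (y ^ k * (c * Re (\<kappa> y)))) = 0"
      using inf_even
    proof (rule INFM_mono)
      fix k :: nat assume "even k"
      then show "(LINT y|lborel. indicator {0<..} y * (y ^ k * (c * Re (\<kappa> y)))) = 0 \<and>
        (LINT y|lborel. indicator {..<0} y * (y ^ k * (c * Re (\<kappa> y)))) = 0"
        using half(1,2)[of k] by (simp add: mult.left_commute[of _ c])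
    qed
  qed measurable
  have im: "\<not> (\<forall>\<^sub>F a in at_right 0. (LINT y|lborel. g (a * y) * (c * Im (\<kappa> y))) > 0)" for c
  proof (rule dilation_average_not_eventually_positive[OF gm _ int])
    show "integrable lborel (\<lambda>y. y ^ k * (c * Im (\<kappa> y)))" for k
      using integrable_mult_right[OF mom(2), of c k] by (simp add: mult_ac)
    show "\<exists>\<^sub>\<infinity>k. (LINT y|lborel. indicator {0<..} y * (y ^ k * (c * Im (\<kappa> y)))) = 0 \<and>
        (LINT y|lborel. indicator {..<0} y * (y ^ k * (c * Im (\<kappa> y)))) = 0"
      using inf_odd
    proof (rule INFM_mono)
      fix k :: nat assume "odd k"
      then show "(LINT y|lborel. indicator {0<..} y * (y ^ k * (c * Im (\<kappa> y)))) = 0 \<and>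
        (LINT y|lborel. indicator {..<0} y * (y ^ k * (c * Im (\<kappa> y)))) = 0"
        using half(3,4)[of k] by (simp add: mult.left_commute[of _ c])
    qed
  qed measurable
  note T = distr_of_dilate[OF w _ f f', where p = p and b = b, folded g_def]
  show ?thesis
  proof (rule signature_zero_if_no_sign)
    show "\<not> (\<forall>\<^sub>F a in at_right 0. Re (distr_of f (dilate_translate \<kappa> a b)) > 0)"
    proof
      assume "\<forall>\<^sub>F a in at_right 0. Re (distr_of f (dilate_translate \<kappa> a b)) > 0"
      with eventually_at_right_less[of 0]
      have "\<forall>\<^sub>F a in at_right 0. (LINT y|lborel. g (a * y) * (1 * Re (\<kappa> y))) > 0"
        by eventually_elim (simp add: T zero_less_mult_iff)
      then show False using re by blast
    qed
    show "\<not> (\<forall>\<^sub>F a in at_right 0. Re (distr_of f (dilate_translate \<kappa> a b)) < 0)"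
    proof
      assume "\<forall>\<^sub>F a in at_right 0. Re (distr_of f (dilate_translate \<kappa> a b)) < 0"
      with eventually_at_right_less[of 0]
      have "\<forall>\<^sub>F a in at_right 0. (LINT y|lborel. g (a * y) * ((- 1) * Re (\<kappa> y))) > 0"
        by eventually_elim (simp add: T mult_less_0_iff)
      then show False using re by blast
    qed
    show "\<not> (\<forall>\<^sub>F a in at_right 0. Im (distr_of f (dilate_translate \<kappa> a b)) > 0)"
    proof
      assume "\<forall>\<^sub>F a in at_right 0. Im (distr_of f (dilate_translate \<kappa> a b)) > 0"
      with eventually_at_right_less[of 0]
      have "\<forall>\<^sub>F a in at_right 0. (LINT y|lborel. g (a * y) * (1 * Im (\<kappa> y))) > 0"
        by eventually_elim (simp add: T zero_less_mult_iff)
      then show False using im by blast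
    qed
    show "\<not> (\<forall>\<^sub>F a in at_right 0. Im (distr_of f (dilate_translate \<kappa> a b)) < 0)"
    proof
      assume "\<forall>\<^sub>F a in at_right 0. Im (distr_of f (dilate_translate \<kappa> a b)) < 0"
      with eventually_at_right_less[of 0]
      have "\<forall>\<^sub>F a in at_right 0. (LINT y|lborel. g (a * y) * ((- 1) * Im (\<kappa> y))) > 0"
        by eventually_elim (simp add: T mult_less_0_iff)
      then show False using im by blast
    qed
  qed
qed

text \<open>Excluding \<open>x = b\<close> avoids a separate treatment of the degenerate case of Taylor's
  theorem and makes no difference up to null sets.\<close>

lemma smooth_taylor_flat:
  fixes f :: "real \<Rightarrow> real"
  assumes S: "open S" "b \<in> S" and smooth: "smooth_on S f"
    and zero: "\<And>k. k \<ge> k0 \<Longrightarrow> nth_vderiv k f b = 0"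
  shows "\<exists>p. \<forall>n. \<exists>\<delta>>0. \<exists>C. \<forall>x. x \<noteq> b \<and> \<bar>x - b\<bar> < \<delta> \<longrightarrow> \<bar>f x - poly p (x - b)\<bar> \<le> C * \<bar>x - b\<bar> ^ n"
proof (rule exI, rule allI)
  fix n :: nat
  \<comment> \<open>Since the derivatives of order at least \<open>k0\<close> vanish at \<open>b\<close>, the Taylor sum below any order \<open>m \<ge> k0\<close> is this polynomial.\<close>
  define p where "p = (\<Sum>j<k0. monom (nth_vderiv j f b / fact j) j)"
  define m where "m = n + k0 + 1"
  have deriv: "(nth_vderiv k f has_real_derivative nth_vderiv (Suc k) f x) (at x)" if "x \<in> S" for k x
  proof -
    have "nth_vderiv k f differentiable (at x)" using smooth that by (simp add: smooth_on_def)
    then have "(nth_vderiv k f has_vector_derivative nth_vderiv (Suc k) f x) (at x)"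
      by (simp add: vector_derivative_works nth_vderiv_def)
    then show ?thesis by (simp add: has_real_derivative_iff_has_vector_derivative)
  qed
  have "isCont (nth_vderiv m f) b" using deriv[OF S(2)] by (rule DERIV_isCont)
  then obtain d1 where d1: "d1 > 0" "\<And>x. \<bar>x - b\<bar> < d1 \<Longrightarrow> \<bar>nth_vderiv m f x - nth_vderiv m f b\<bar> < 1"
    unfolding continuous_at_eps_delta by (auto simp: dist_real_def dest: spec[of _ 1])
  obtain d2 where d2: "d2 > 0" "ball b d2 \<subseteq> S" using S open_contains_ball by blast
  define e where "e = Min {d1, d2, 1} / 2"
  have e: "e > 0" "e < d1" "e < d2" "e < 1" using d1(1) d2(1) by (auto simp: e_def min_def)
  have "\<bar>f x - poly p (x - b)\<bar> \<le> 1 * \<bar>x - b\<bar> ^ n" if x: "x \<noteq> b" "\<bar>x - b\<bar> < e" for x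
  proof -
    have "\<exists>t. (if x < b then x < t \<and> t < b else b < t \<and> t < x) \<and>
        f x = (\<Sum>i<m. nth_vderiv i f b / fact i * (x - b) ^ i) + nth_vderiv m f t / fact m * (x - b) ^ m"
    proof (rule Taylor)
      show "0 < m" by (simp add: m_def)
      show "nth_vderiv 0 f = f" by (simp add: nth_vderiv_def)
      show "\<forall>i t. i < m \<and> b - e \<le> t \<and> t \<le> b + e \<longrightarrow> (nth_vderiv i f has_real_derivative nth_vderiv (Suc i) f t) (at t)"
      proof (intro allI impI deriv)
        fix i t assume "i < m \<and> b - e \<le> t \<and> t \<le> b + e"
        then have "t \<in> ball b d2" using e(3) by (auto simp: dist_real_def)
        then show "t \<in> S" using d2 by auto
      qed
    qed (use x e(1) in \<open>auto\<close>)
    then obtain t where t0: "if x < b then x < t \<and> t < b else b < t \<and> t < x"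
      and eq: "f x = (\<Sum>i<m. nth_vderiv i f b / fact i * (x - b) ^ i) + nth_vderiv m f t / fact m * (x - b) ^ m"
      by blast
    have t: "\<bar>t - b\<bar> < e" using t0 x by (auto split: if_splits)
    have "(\<Sum>i<m. nth_vderiv i f b / fact i * (x - b) ^ i) = (\<Sum>i<k0. nth_vderiv i f b / fact i * (x - b) ^ i)"
      by (rule sum.mono_neutral_right) (auto simp: m_def zero)
    also have "\<dots> = poly p (x - b)" by (simp add: p_def poly_sum poly_monom)
    finally have "f x - poly p (x - b) = nth_vderiv m f t / fact m * (x - b) ^ m" using eq by simp
    moreover have "\<bar>nth_vderiv m f t\<bar> \<le> 1"
      using d1(2)[of t] t e(2) zero[of m] by (simp add: m_def)
    then have "\<bar>nth_vderiv m f t / fact m\<bar> \<le> 1"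
      by (simp add: abs_divide divide_le_eq_1 order_trans[OF _ fact_ge_1])
    then have "\<bar>nth_vderiv m f t / fact m\<bar> * \<bar>x - b\<bar> ^ m \<le> 1 * \<bar>x - b\<bar> ^ m"
      by (intro mult_right_mono) auto
    moreover have "\<bar>x - b\<bar> ^ m \<le> \<bar>x - b\<bar> ^ n"
      using x e(4) by (intro power_decreasing) (auto simp: m_def)
    ultimately show ?thesis by (simp add: abs_mult power_abs)
  qed
  then show "\<exists>\<delta>>0. \<exists>C. \<forall>x. x \<noteq> b \<and> \<bar>x - b\<bar> < \<delta> \<longrightarrow> \<bar>f x - poly p (x - b)\<bar> \<le> C * \<bar>x - b\<bar> ^ n"
    using e(1) by (intro exI[of _ e] conjI exI[of _ 1] allI impI) auto
qed

section \<open>Functions that vanish as distributions\<close>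

text \<open>The positive and the negative part of \<open>w\<close> are densities of finite measures with the
  same cumulative distribution function.\<close>

lemma AE_zero_if_initial_integrals_zero:
  fixes w :: "real \<Rightarrow> real"
  assumes w: "integrable lborel w" and zero: "\<And>x. (LINT t|lborel. indicator {..x} t * w t) = 0"
  shows "AE x in lborel. w x = 0"
proof (rule AE_zero_if_density_eq)
  show [measurable]: "w \<in> borel_measurable borel" using w by auto
  have int: "integrable lborel (\<lambda>t. indicator {..x} t * max 0 (u t))" if "integrable lborel u"
    for u :: "real \<Rightarrow> real" and x
    by (rule Bochner_Integration.integrable_bound[OF that]) (use that in \<open>auto simp: indicator_def\<close>)
  have em: "emeasure (density lborel (\<lambda>t. ennreal (u t))) {..x} = ennreal (LINT t|lborel. indicator {..x} t * max 0 (u t))"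
    if u: "integrable lborel u" for u :: "real \<Rightarrow> real" and x
  proof -
    have [measurable]: "u \<in> borel_measurable borel" using u by auto
    have "emeasure (density lborel (\<lambda>t. ennreal (u t))) {..x} = (\<integral>\<^sup>+t. ennreal (u t) * indicator {..x} t \<partial>lborel)"
      by (rule emeasure_density) auto
    also have "\<dots> = (\<integral>\<^sup>+t. ennreal (indicator {..x} t * max 0 (u t)) \<partial>lborel)"
      by (intro nn_integral_cong) (auto simp: indicator_def max_def ennreal_neg)
    also have "\<dots> = ennreal (LINT t|lborel. indicator {..x} t * max 0 (u t))"
      by (rule nn_integral_eq_integral[OF int[OF u]]) auto
    finally show ?thesis .
  qed
  have cdf: "cdf (density lborel (\<lambda>t. ennreal (u t))) x = (LINT t|lborel. indicator {..x} t * max 0 (u t))"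
    if "integrable lborel u" for u :: "real \<Rightarrow> real" and x
    unfolding cdf_def measure_def em[OF that] by (intro enn2real_ennreal integral_nonneg_AE) auto
  have fin: "finite_borel_measure (density lborel (\<lambda>t. ennreal (u t)))"
    if u: "integrable lborel u" for u :: "real \<Rightarrow> real"
  proof -
    have [measurable]: "u \<in> borel_measurable borel" using u by auto
    have "(\<integral>\<^sup>+t. ennreal (u t) \<partial>lborel) \<le> (\<integral>\<^sup>+t. ennreal (norm (u t)) \<partial>lborel)"
      by (intro nn_integral_mono ennreal_leI) auto
    also have "\<dots> < \<infinity>" using u by (simp add: integrable_iff_bounded)
    finally have "(\<integral>\<^sup>+t. ennreal (u t) \<partial>lborel) \<noteq> \<infinity>" by simp
    then have "finite_measure (density lborel (\<lambda>t. ennreal (u t)))"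
      by (intro finite_measureI) (simp add: emeasure_density)
    then show ?thesis
      by (intro finite_borel_measure.intro finite_borel_measure_axioms.intro) simp_all
  qed
  have w': "integrable lborel (\<lambda>t. - w t)" using w by simp
  show "density lborel (\<lambda>x. ennreal (w x)) = density lborel (\<lambda>x. ennreal (- w x))"
  proof (rule cdf_unique'[OF fin[OF w] fin[OF w']], rule ext)
    fix x
    have "(LINT t|lborel. indicator {..x} t * max 0 (w t)) - (LINT t|lborel. indicator {..x} t * max 0 (- w t)) =
        (LINT t|lborel. indicator {..x} t * w t)"
      by (subst Bochner_Integration.integral_diff[symmetric, OF int[OF w] int[OF w']])
        (auto intro!: Bochner_Integration.integral_cong simp: indicator_def max_def)
    then show "cdf (density lborel (\<lambda>x. ennreal (w x))) x = cdf (density lborel (\<lambda>x. ennreal (- w x))) x"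
      unfolding cdf[OF w] cdf[OF w'] using zero[of x] by simp
  qed
qed

text \<open>The test function \<open>bump u v e 0 1\<close> is
  \<open>exp (- e / ((x - u) (v - x)))\<close> on \<open>(u, v)\<close>. The general form, with a
  polynomial factor and a power of the singular factor, makes the family closed under differentiation. As
  \<open>e\<close> tends to 0, the test functions increase to the indicator of \<open>(u, v)\<close>.\<close>

definition bump :: "real \<Rightarrow> real \<Rightarrow> real \<Rightarrow> nat \<Rightarrow> real poly \<Rightarrow> real \<Rightarrow> real" where
  "bump u v e j P x = (if u < x \<and> x < v
     then poly P x * inverse ((x - u) * (v - x)) ^ j * exp (- (e * inverse ((x - u) * (v - x)))) else 0)"

text \<open>From \<open>1 + z \<le> exp z\<close> at \<open>z = e s / Suc n\<close>, raised to the
  power \<open>Suc n\<close>.\<close>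

lemma power_times_exp_le:
  fixes e s :: real
  assumes "e > 0" "s \<ge> 0"
  shows "s ^ Suc n * exp (- (e * s)) \<le> (real (Suc n) / e) ^ Suc n"
proof -
  have "e * s / real (Suc n) \<le> exp (e * s / real (Suc n))"
    using exp_ge_add_one_self[of "e * s / real (Suc n)"] by linarith
  then have "(e * s / real (Suc n)) ^ Suc n \<le> exp (e * s / real (Suc n)) ^ Suc n"
    using assms by (intro power_mono) auto
  also have "\<dots> = exp (e * s)" by (simp flip: exp_of_nat_mult del: power_Suc of_nat_Suc)
  finally have le: "(e * s / real (Suc n)) ^ Suc n \<le> exp (e * s)" .
  have "s ^ Suc n = (real (Suc n) / e) ^ Suc n * (e * s / real (Suc n)) ^ Suc n"
    using assms by (simp add: power_mult_distrib[symmetric] del: power_Suc of_nat_Suc)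
  also have "\<dots> \<le> (real (Suc n) / e) ^ Suc n * exp (e * s)"
    using assms le by (intro mult_left_mono) auto
  finally show ?thesis by (simp add: exp_minus field_simps del: power_Suc of_nat_Suc)
qed

text \<open>The exponential beats every power of the singular factor \<open>1 / D\<close>, so the function
  is dominated by \<open>D\<^sup>2\<close>, and \<open>D = (x - u) (v - x)\<close> vanishes to first
  order at either endpoint. This yields differentiability at the endpoints.\<close>

lemma bump_quadratic_bound:
  assumes "u < v" "e > 0"
  shows "\<exists>C. \<forall>x. \<bar>bump u v e j P x\<bar> \<le> C * (x - u)\<^sup>2 \<and> \<bar>bump u v e j P x\<bar> \<le> C * (x - v)\<^sup>2"
proof -
  have "compact (poly P ` {u..v})" by (intro compact_continuous_image continuous_intros) auto
  then obtain B where B: "\<And>x. u \<le> x \<Longrightarrow> x \<le> v \<Longrightarrow> \<bar>poly P x\<bar> \<le> B"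
    using compact_imp_bounded bounded_iff by (metis (no_types, lifting) atLeastAtMost_iff imageI real_norm_def)
  have "B \<ge> 0" using B[of u] assms(1) by (auto intro: order_trans[OF abs_ge_zero])
  define K where "K = (real (j + 2) / e) ^ (j + 2)"
  have "K \<ge> 0" using assms(2) by (simp add: K_def)
  define C where "C = B * K * (v - u)\<^sup>2"
  have "C \<ge> 0" using \<open>B \<ge> 0\<close> \<open>K \<ge> 0\<close> by (simp add: C_def)
  have "\<bar>bump u v e j P x\<bar> \<le> C * (x - u)\<^sup>2 \<and> \<bar>bump u v e j P x\<bar> \<le> C * (x - v)\<^sup>2" for x
  proof (cases "u < x \<and> x < v")
    case True
    define D where "D = (x - u) * (v - x)"
    have D: "D > 0" using True by (simp add: D_def)
    have "inverse D ^ j * exp (- (e * inverse D)) = D\<^sup>2 * (inverse D ^ (j + 2) * exp (- (e * inverse D)))"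
      using D by (simp add: power_add field_simps power2_eq_square)
    also have "\<dots> \<le> D\<^sup>2 * K"
      unfolding K_def using power_times_exp_le[of e "inverse D" "Suc j"] assms(2) D
      by (intro mult_left_mono) auto
    finally have "\<bar>poly P x\<bar> * (inverse D ^ j * exp (- (e * inverse D))) \<le> B * (D\<^sup>2 * K)"
      using True D \<open>B \<ge> 0\<close> by (intro mult_mono[OF B]) auto
    then have le: "\<bar>bump u v e j P x\<bar> \<le> B * K * D\<^sup>2"
      using True D by (simp add: bump_def abs_mult flip: D_def) (simp add: mult_ac)
    have "D \<le> (v - u) * (x - u)" "D \<le> (v - u) * (v - x)"
      unfolding D_def using True by (simp_all add: mult.commute mult_left_mono mult_right_mono)
    then have "D\<^sup>2 \<le> ((v - u) * (x - u))\<^sup>2" "D\<^sup>2 \<le> ((v - u) * (v - x))\<^sup>2"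
      using D by (auto intro!: power_mono)
    then have "B * K * D\<^sup>2 \<le> B * K * ((v - u) * (x - u))\<^sup>2" "B * K * D\<^sup>2 \<le> B * K * ((v - u) * (v - x))\<^sup>2"
      using \<open>B \<ge> 0\<close> \<open>K \<ge> 0\<close> by (auto intro!: mult_left_mono)
    with le show ?thesis
      by (simp add: C_def power_mult_distrib mult.assoc power2_commute[of x v])
  next
    case False
    then show ?thesis using \<open>C \<ge> 0\<close> by (auto simp: bump_def)
  qed
  then show ?thesis by blast
qed

lemma has_derivative_zero_if_quadratic:
  fixes g :: "real \<Rightarrow> real"
  assumes bound: "\<And>x. \<bar>g x\<bar> \<le> C * (x - a)\<^sup>2"
  shows "(g has_real_derivative 0) (at a)"
proof -
  have "g a = 0" using bound[of a] by simp
  have "((\<lambda>x. C * \<bar>x - a\<bar>) \<longlongrightarrow> C * \<bar>a - a\<bar>) (at a)" by (intro tendsto_intros)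
  then have lim: "((\<lambda>x. C * \<bar>x - a\<bar>) \<longlongrightarrow> 0) (at a)" by simp
  have "((\<lambda>x. (g x - g a) / (x - a)) \<longlongrightarrow> 0) (at a)"
  proof (rule Lim_null_comparison[OF _ lim])
    show "\<forall>\<^sub>F x in at a. norm ((g x - g a) / (x - a)) \<le> C * \<bar>x - a\<bar>"
    proof (intro eventually_at_topological[THEN iffD2] exI[of _ UNIV] conjI ballI impI)
      fix x assume "x \<noteq> a"
      then have "\<bar>g x\<bar> / \<bar>x - a\<bar> \<le> C * (x - a)\<^sup>2 / \<bar>x - a\<bar>" by (intro divide_right_mono bound) auto
      also have "\<dots> = C * \<bar>x - a\<bar>"
      proof -
        have eq: "(x - a)\<^sup>2 = \<bar>x - a\<bar> * \<bar>x - a\<bar>" by (simp add: power2_eq_square)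
        show ?thesis unfolding eq using \<open>x \<noteq> a\<close> by (simp del: abs_mult_self_eq)
      qed
      finally show "norm ((g x - g a) / (x - a)) \<le> C * \<bar>x - a\<bar>"
        using \<open>g a = 0\<close> by (simp add: abs_divide)
    qed auto
  qed
  then show ?thesis by (simp add: has_field_derivative_iff)
qed

lemma bump_derivative:
  assumes "u < v" "e > 0"
  shows "\<exists>P'. \<forall>x. (bump u v e j P has_real_derivative bump u v e (j + 2) P' x) (at x)"
proof (intro exI allI)
  fix x
  \<comment> \<open>The derivative of \<open>P s ^ j exp (- e s)\<close> for \<open>s = 1 / D\<close> is \<open>P' s ^ (j + 2) exp (- e s)\<close>.\<close>
  define D where "D = [:- u, 1:] * [:v, - 1:]"
  define P' where "P' = pderiv P * D\<^sup>2 - smult (real j) (P * pderiv D * D) + smult e (P * pderiv D)"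
  have D: "poly D x = (x - u) * (v - x)" for x unfolding D_def poly_mult by simp
  obtain C where C: "\<And>x. \<bar>bump u v e j P x\<bar> \<le> C * (x - u)\<^sup>2" "\<And>x. \<bar>bump u v e j P x\<bar> \<le> C * (x - v)\<^sup>2"
    using bump_quadratic_bound[OF assms] by blast
  consider "u < x \<and> x < v" | "x < u \<or> v < x" | "x = u" | "x = v" by linarith
  then show "(bump u v e j P has_real_derivative bump u v e (j + 2) P' x) (at x)"
  proof cases
    case 1
    define s where "s y = inverse (poly D y)" for y
    have nz: "poly D x \<noteq> 0" using 1 by (simp add: D)
    have ds: "(s has_real_derivative - (poly (pderiv D) x * (s x)\<^sup>2)) (at x)"
      unfolding s_def[abs_def]
      using DERIV_inverse_fun[OF poly_DERIV nz] by (simp only: power_inverse numeral_2_eq_2)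
    have dsj: "((\<lambda>y. s y ^ j) has_real_derivative - (real j * poly (pderiv D) x * s x ^ Suc j)) (at x)"
    proof (rule DERIV_cong[OF DERIV_power[OF ds, of j]])
      show "real j * (- (poly (pderiv D) x * (s x)\<^sup>2) * s x ^ (j - Suc 0)) = - (real j * poly (pderiv D) x * s x ^ Suc j)"
        by (cases j) (simp_all add: power2_eq_square)
    qed
    have "((\<lambda>y. poly P y * s y ^ j * exp (- (e * s y))) has_real_derivative
        (poly (pderiv P) x * s x ^ j + poly P x * - (real j * poly (pderiv D) x * s x ^ Suc j)) * exp (- (e * s x))
        + poly P x * s x ^ j * (exp (- (e * s x)) * (e * (poly (pderiv D) x * (s x)\<^sup>2)))) (at x)"
    proof -
      have "((\<lambda>y. exp (- (e * s y))) has_real_derivative exp (- (e * s x)) * (e * (poly (pderiv D) x * (s x)\<^sup>2))) (at x)"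
        by (rule DERIV_cong[OF DERIV_fun_exp[OF DERIV_minus[OF DERIV_cmult[OF ds]]]]) simp
      from DERIV_mult[OF DERIV_mult[OF poly_DERIV[of P x] dsj] this] show ?thesis
        by (rule DERIV_cong) (simp add: algebra_simps)
    qed
    also have "(poly (pderiv P) x * s x ^ j + poly P x * - (real j * poly (pderiv D) x * s x ^ Suc j)) * exp (- (e * s x))
        + poly P x * s x ^ j * (exp (- (e * s x)) * (e * (poly (pderiv D) x * (s x)\<^sup>2))) =
        poly P' x * s x ^ (j + 2) * exp (- (e * s x))"
    proof -
      have gen: "(a * (D2 * q) + p * - (r * d * (D1 * q)) + p * e * d * q) * E =
          (a * D2 - r * (p * d * D1) + e * (p * d)) * q * E" for a D2 q p r d D1 E :: real
        by (simp add: algebra_simps)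
      have 1: "poly D x * s x = 1" using nz by (simp add: s_def)
      have "s x ^ j = (poly D x * s x)\<^sup>2 * s x ^ j" "s x ^ Suc j = (poly D x * s x) * s x ^ Suc j" by (simp_all only: 1 power_one mult_1)
      then have 2: "s x ^ j = (poly D x)\<^sup>2 * s x ^ (j + 2)" "s x ^ Suc j = poly D x * s x ^ (j + 2)"
        by (simp_all add: power_add power2_eq_square mult_ac)
      have "(poly (pderiv P) x * s x ^ j + poly P x * - (real j * poly (pderiv D) x * s x ^ Suc j)) * exp (- (e * s x))
          + poly P x * s x ^ j * (exp (- (e * s x)) * (e * (poly (pderiv D) x * (s x)\<^sup>2))) =
          (poly (pderiv P) x * s x ^ j + poly P x * - (real j * poly (pderiv D) x * s x ^ Suc j)
          + poly P x * e * poly (pderiv D) x * s x ^ (j + 2)) * exp (- (e * s x))"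
        by (simp only: power_add distrib_right distrib_left mult_ac)
      also have "\<dots> = poly P' x * s x ^ (j + 2) * exp (- (e * s x))"
        unfolding 2 P'_def by (simp only: poly_add poly_diff poly_mult poly_smult poly_power gen)
      finally show ?thesis .
    qed
    finally have "((\<lambda>y. poly P y * s y ^ j * exp (- (e * s y))) has_real_derivative
        poly P' x * s x ^ (j + 2) * exp (- (e * s x))) (at x)" .
    then have main: "((\<lambda>y. poly P y * s y ^ j * exp (- (e * s y))) has_real_derivative bump u v e (j + 2) P' x) (at x)"
      using 1 by (simp add: bump_def s_def D)
    have inside: "poly P y * s y ^ j * exp (- (e * s y)) = bump u v e j P y" if "y \<in> {u<..<v}" for y
      using that by (simp add: bump_def s_def D)
    from main show ?thesis
    proof (rule has_field_derivative_transform_within_open)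
      show "x \<in> {u<..<v}" using 1 by simp
      show "open {u<..<v}" by (rule open_greaterThanLessThan)
      show "poly P y * s y ^ j * exp (- (e * s y)) = bump u v e j P y" if "y \<in> {u<..<v}" for y
        using that by (rule inside)
    qed
  next
    case 2
    have "((\<lambda>_. 0) has_real_derivative bump u v e (j + 2) P' x) (at x)"
      using 2 by (auto simp: bump_def)
    then show ?thesis
    proof (rule has_field_derivative_transform_within_open)
      show "open ({..<u} \<union> {v<..})" by (intro open_Un open_lessThan open_greaterThan)
      show "x \<in> {..<u} \<union> {v<..}" using 2 by auto
      show "0 = bump u v e j P y" if "y \<in> {..<u} \<union> {v<..}" for y
        using that by (auto simp: bump_def)
    qed
  next
    case 3
    then have "bump u v e (j + 2) P' x = 0" by (simp add: bump_def)
    then show ?thesis using has_derivative_zero_if_quadratic[OF C(1)] 3 by simp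
  next
    case 4
    then have "bump u v e (j + 2) P' x = 0" by (simp add: bump_def)
    then show ?thesis using has_derivative_zero_if_quadratic[OF C(2)] 4 by simp
  qed
qed

lemma nth_vderiv_bump:
  assumes "u < v" "e > 0"
  shows "\<exists>j P. nth_vderiv k (\<lambda>x. complex_of_real (bump u v e 0 1 x)) = (\<lambda>x. complex_of_real (bump u v e j P x))"
proof (induction k)
  case 0
  then show ?case by (auto simp: nth_vderiv_def)
next
  case (Suc k)
  then obtain j P where IH: "nth_vderiv k (\<lambda>x. complex_of_real (bump u v e 0 1 x)) = (\<lambda>x. complex_of_real (bump u v e j P x))"
    by blast
  obtain P' where P': "\<And>x. (bump u v e j P has_real_derivative bump u v e (j + 2) P' x) (at x)"
    using bump_derivative[OF assms] by blast
  have "vector_derivative (\<lambda>x. complex_of_real (bump u v e j P x)) (at x) = complex_of_real (bump u v e (j + 2) P' x)" for x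
    by (intro vector_derivative_at has_vector_derivative_of_real) (use P' in \<open>simp add: has_real_derivative_iff_has_vector_derivative\<close>)
  then have "nth_vderiv (Suc k) (\<lambda>x. complex_of_real (bump u v e 0 1 x)) = (\<lambda>x. complex_of_real (bump u v e (j + 2) P' x))"
    using IH by (simp add: nth_vderiv_def)
  then show ?case by blast
qed

lemma test_function_bump:
  assumes "u < v" "e > 0"
  shows "test_function (\<lambda>x. complex_of_real (bump u v e 0 1 x))"
    and "fun_supp (\<lambda>x. complex_of_real (bump u v e 0 1 x)) \<subseteq> {u..v}"
proof -
  show supp: "fun_supp (\<lambda>x. complex_of_real (bump u v e 0 1 x)) \<subseteq> {u..v}"
    unfolding fun_supp_def by (intro closure_minimal) (auto simp: bump_def split: if_splits)
  have "smooth_on UNIV (\<lambda>x. complex_of_real (bump u v e 0 1 x))"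
    unfolding smooth_on_def
  proof (intro allI ballI)
    fix k x
    obtain j P where jP: "nth_vderiv k (\<lambda>x. complex_of_real (bump u v e 0 1 x)) = (\<lambda>x. complex_of_real (bump u v e j P x))"
      using nth_vderiv_bump[OF assms] by blast
    obtain P' where P': "\<And>x. (bump u v e j P has_real_derivative bump u v e (j + 2) P' x) (at x)"
      using bump_derivative[OF assms] by blast
    have "((\<lambda>x. complex_of_real (bump u v e j P x)) has_vector_derivative complex_of_real (bump u v e (j + 2) P' x)) (at x)"
      by (intro has_vector_derivative_of_real) (use P' in \<open>simp add: has_real_derivative_iff_has_vector_derivative\<close>)
    then show "nth_vderiv k (\<lambda>x. complex_of_real (bump u v e 0 1 x)) differentiable at x"
      unfolding jP by (rule differentiableI_vector)
  qed
  moreover have "compact (fun_supp (\<lambda>x. complex_of_real (bump u v e 0 1 x)))"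
    unfolding compact_eq_bounded_closed
    using bounded_subset[OF bounded_closed_interval supp] by (simp add: fun_supp_def)
  ultimately show "test_function (\<lambda>x. complex_of_real (bump u v e 0 1 x))"
    by (simp add: test_function_def)
qed

lemma bump_borel_measurable [measurable]: "bump u v e j P \<in> borel_measurable borel"
  unfolding bump_def[abs_def] by measurable

lemma bump_tendsto_indicator:
  "(\<lambda>n. bump u v (1 / real (Suc n)) 0 1 x) \<longlonglongrightarrow> indicator {u<..<v} x"
proof (cases "u < x \<and> x < v")
  case True
  have "(\<lambda>n. exp (- (1 / real (Suc n) * inverse ((x - u) * (v - x))))) \<longlonglongrightarrow> exp (- (0 * inverse ((x - u) * (v - x))))"
    by (intro tendsto_intros LIMSEQ_Suc[OF lim_1_over_n])
  then show ?thesis using True by (simp add: bump_def)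
qed (auto simp: bump_def)

text \<open>The fundamental lemma of the calculus of variations: letting the bump functions tend to the
  indicator of an interval in \<open>U\<close> shows that \<open>f\<close> integrates to 0 over all such
  intervals.\<close>

lemma AE_zero_near_if_distr_zero:
  assumes loc: "locally_integrable f" and growth: "polynomial_growth f"
    and U: "open U" "b \<in> U"
    and zero: "\<And>\<phi>. test_function \<phi> \<Longrightarrow> fun_supp \<phi> \<subseteq> U \<Longrightarrow> distr_of f \<phi> = 0"
  shows "\<exists>\<delta>>0. AE x in lborel. \<bar>x - b\<bar> < \<delta> \<longrightarrow> f x = 0"
proof -
  have f: "f \<in> borel_measurable lebesgue" by (rule tempered_borel_representative[OF loc growth])
  obtain f' M where [measurable]: "f' \<in> borel_measurable borel" and eq: "AE x in lborel. f x = f' x"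
    using tempered_borel_representative(2)[OF loc growth] by blast
  have int: "integrable lborel (\<lambda>x. indicator {u<..<v} x * f' x)" for u v
  proof -
    have "integrable lebesgue (\<lambda>x. indicator {u..v} x *\<^sub>R f x)"
      using loc unfolding locally_integrable_def set_integrable_def by auto
    then have "integrable lebesgue (\<lambda>x. indicator {u..v} x * f' x)"
    proof (rule integrable_cong_AE_imp)
      show "AE x in lebesgue. indicator {u..v} x *\<^sub>R f x = indicator {u..v} x * f' x"
        using AE_completion[OF eq] by eventually_elim simp
      show "(\<lambda>x. indicator {u..v} x * f' x) \<in> borel_measurable lebesgue"
        by (rule measurable_completion) measurable
    qed
    then have "integrable lborel (\<lambda>x. indicator {u..v} x * f' x)"
      by (subst (asm) integrable_completion) auto
    then show ?thesis
      by (rule Bochner_Integration.integrable_bound) (auto simp: indicator_def)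
  qed
  have interval: "(LINT x|lborel. indicator {u<..<v} x * f' x) = 0" if uv: "u < v" "{u..v} \<subseteq> U" for u v
  proof -
    have "(LINT x|lborel. bump u v (1 / real (Suc n)) 0 1 x * f' x) = 0" for n
    proof -
      have e: "1 / real (Suc n) > 0" by simp
      have "fun_supp (\<lambda>x. complex_of_real (bump u v (1 / real (Suc n)) 0 1 x)) \<subseteq> U"
        using test_function_bump(2)[OF uv(1) e] uv(2) by blast
      then have "distr_of f (\<lambda>x. complex_of_real (bump u v (1 / real (Suc n)) 0 1 x)) = 0"
        by (rule zero[OF test_function_bump(1)[OF uv(1) e]])
      moreover have "distr_of f (\<lambda>x. complex_of_real (bump u v (1 / real (Suc n)) 0 1 x)) =
          (LINT x|lborel. complex_of_real (f' x) * complex_of_real (bump u v (1 / real (Suc n)) 0 1 x))"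
        by (rule distr_of_eq_lborel[OF f _ _ eq]) measurable
      moreover have "\<dots> = complex_of_real (LINT x|lborel. bump u v (1 / real (Suc n)) 0 1 x * f' x)"
        by (simp only: integral_complex_of_real[symmetric] of_real_mult mult.commute)
      ultimately show ?thesis by simp
    qed
    moreover have "(\<lambda>n. LINT x|lborel. bump u v (1 / real (Suc n)) 0 1 x * f' x) \<longlonglongrightarrow> (LINT x|lborel. indicator {u<..<v} x * f' x)"
    proof (rule integral_dominated_convergence)
      show "integrable lborel (\<lambda>x. norm (indicator {u<..<v} x * f' x))"
        using int by (rule integrable_norm)
      show "AE x in lborel. (\<lambda>n. bump u v (1 / real (Suc n)) 0 1 x * f' x) \<longlonglongrightarrow> indicator {u<..<v} x * f' x"
        by (intro AE_I2 tendsto_mult tendsto_const bump_tendsto_indicator)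
      fix n
      have "\<bar>bump u v (1 / real (Suc n)) 0 1 x\<bar> \<le> indicator {u<..<v} x" for x
      proof (cases "u < x \<and> x < v")
        case True
        then have "0 \<le> 1 / real (Suc n) * inverse ((x - u) * (v - x))"
          by (intro mult_nonneg_nonneg) auto
        then show ?thesis using True by (simp add: bump_def del: of_nat_Suc)
      qed (auto simp: bump_def)
      then have "\<bar>bump u v (1 / real (Suc n)) 0 1 x\<bar> * \<bar>f' x\<bar> \<le> indicator {u<..<v} x * \<bar>f' x\<bar>" for x
        by (intro mult_right_mono) auto
      then show "AE x in lborel. norm (bump u v (1 / real (Suc n)) 0 1 x * f' x) \<le> norm (indicator {u<..<v} x * f' x)"
        by (intro AE_I2) (simp add: abs_mult)
    qed measurable
    ultimately show ?thesis by (simp add: LIMSEQ_const_iff)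
  qed
  obtain \<delta> where \<delta>: "\<delta> > 0" "cball b \<delta> \<subseteq> U" using U open_contains_cball by blast
  then have sub: "{b - \<delta>..b + \<delta>} \<subseteq> U" by (auto simp: cball_eq_atLeastAtMost)
  have "AE x in lborel. indicator {b - \<delta><..<b + \<delta>} x * f' x = 0"
  proof (rule AE_zero_if_initial_integrals_zero[OF int])
    fix x
    \<comment> \<open>The part of the neighborhood below \<open>x\<close> is again an interval, up to one point.\<close>
    define c where "c = min x (b + \<delta>)"
    have "(LINT t|lborel. indicator {..x} t * (indicator {b - \<delta><..<b + \<delta>} t * f' t)) =
        (LINT t|lborel. indicator {b - \<delta><..<c} t * f' t)"
    proof (rule integral_cong_AE)
      show "AE t in lborel. indicator {..x} t * (indicator {b - \<delta><..<b + \<delta>} t * f' t) = indicator {b - \<delta><..<c} t * f' t"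
        using AE_lborel_singleton[of x]
      proof eventually_elim
        case (elim t)
        then have "t \<in> {..x} \<inter> {b - \<delta><..<b + \<delta>} \<longleftrightarrow> t \<in> {b - \<delta><..<c}" by (auto simp: c_def)
        then have "indicator ({..x} \<inter> {b - \<delta><..<b + \<delta>}) t = (indicator {b - \<delta><..<c} t :: real)"
          by (simp only: indicator_def)
        then show ?case by (simp only: indicator_inter_arith mult.assoc[symmetric])
      qed
    qed measurable
    also have "\<dots> = 0"
    proof (cases "b - \<delta> < c")
      case True
      then show ?thesis by (rule interval) (use sub in \<open>auto simp: c_def\<close>)
    next
      case False
      then have "{b - \<delta><..<c} = {}" by auto
      then show ?thesis by simp
    qed
    finally show "(LINT t|lborel. indicator {..x} t * (indicator {b - \<delta><..<b + \<delta>} t * f' t)) = 0" .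
  qed
  with eq have "AE x in lborel. \<bar>x - b\<bar> < \<delta> \<longrightarrow> f x = 0"
  proof eventually_elim
    case (elim x)
    show ?case
    proof
      assume "\<bar>x - b\<bar> < \<delta>"
      then have "x \<in> {b - \<delta><..<b + \<delta>}" by auto
      with elim show "f x = 0" by simp
    qed
  qed
  with \<delta>(1) show ?thesis by blast
qed

section \<open>Vanishing of the signature\<close>

theorem theorem3p2:
  fixes \<kappa> :: "real \<Rightarrow> complex"
  assumes "signature_wavelet \<kappa>"
  shows
    "(\<forall>(f :: real \<Rightarrow> real) b.
        locally_integrable f \<and> polynomial_growth f \<and>
        (\<exists>S. open S \<and> b \<in> S \<and> smooth_on S f) \<and>
        (\<exists>k0. \<forall>k\<ge>k0. nth_vderiv k f b = 0) \<longrightarrow>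
        signature \<kappa> (distr_of f) b = 0) \<and>
     (\<forall>(f :: real \<Rightarrow> real) U (p :: real poly).
        locally_integrable f \<and> polynomial_growth f \<and>
        open U \<and> (\<forall>x\<in>U. f x = poly p x) \<longrightarrow>
        (\<forall>b\<in>U. signature \<kappa> (distr_of f) b = 0)) \<and>
     (\<forall>f :: real \<Rightarrow> real.
        locally_integrable f \<and> polynomial_growth f \<longrightarrow>
        fun_supp (signature \<kappa> (distr_of f)) \<subseteq> distr_supp (distr_of f))"
proof (intro conjI allI impI; (elim conjE exE)?)
  fix f :: "real \<Rightarrow> real" and b S k0
  assume f: "locally_integrable f" "polynomial_growth f" and S: "open S" "b \<in> S" "smooth_on S f"
    and k0: "\<forall>k\<ge>k0. nth_vderiv k f b = 0"
  have "\<exists>p. \<forall>n. \<exists>\<delta>>0. \<exists>C. \<forall>x. x \<noteq> b \<and> \<bar>x - b\<bar> < \<delta> \<longrightarrow> \<bar>f x - poly p (x - b)\<bar> \<le> C * \<bar>x - b\<bar> ^ n"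
    by (rule smooth_taylor_flat[OF S]) (rule k0[rule_format])
  then obtain p where p: "\<forall>n. \<exists>\<delta>>0. \<exists>C. \<forall>x. x \<noteq> b \<and> \<bar>x - b\<bar> < \<delta> \<longrightarrow> \<bar>f x - poly p (x - b)\<bar> \<le> C * \<bar>x - b\<bar> ^ n" ..
  show "signature \<kappa> (distr_of f) b = 0"
  proof (rule signature_zero_if_flat[OF assms f])
    fix n
    obtain \<delta> C where "\<delta> > 0" and C: "\<forall>x. x \<noteq> b \<and> \<bar>x - b\<bar> < \<delta> \<longrightarrow> \<bar>f x - poly p (x - b)\<bar> \<le> C * \<bar>x - b\<bar> ^ n"
      using p[rule_format, of n] by blast
    moreover have "AE x in lborel. \<bar>x - b\<bar> < \<delta> \<longrightarrow> \<bar>f x - poly p (x - b)\<bar> \<le> C * \<bar>x - b\<bar> ^ n"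
      using AE_lborel_singleton[of b] by eventually_elim (use C in auto)
    ultimately show "\<exists>\<delta>>0. \<exists>C. AE x in lborel. \<bar>x - b\<bar> < \<delta> \<longrightarrow> \<bar>f x - poly p (x - b)\<bar> \<le> C * \<bar>x - b\<bar> ^ n"
      by blast
  qed
next
  fix f :: "real \<Rightarrow> real" and U and p :: "real poly"
  assume f: "locally_integrable f" "polynomial_growth f" and U: "open U" "\<forall>x\<in>U. f x = poly p x"
  show "\<forall>b\<in>U. signature \<kappa> (distr_of f) b = 0"
  proof
    fix b assume "b \<in> U"
    with U(1) obtain \<delta> where \<delta>: "\<delta> > 0" "ball b \<delta> \<subseteq> U" using open_contains_ball by blast
    show "signature \<kappa> (distr_of f) b = 0"
    proof (rule signature_zero_if_flat[OF assms f])
      fix n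
      have "\<bar>f x - poly (pcompose p [:b, 1:]) (x - b)\<bar> \<le> 0 * \<bar>x - b\<bar> ^ n" if "\<bar>x - b\<bar> < \<delta>" for x
      proof -
        have "x \<in> U" using that \<delta>(2) by (auto simp: dist_real_def)
        then show ?thesis using U(2) by (simp add: poly_pcompose)
      qed
      then show "\<exists>\<delta>>0. \<exists>C. AE x in lborel. \<bar>x - b\<bar> < \<delta> \<longrightarrow>
          \<bar>f x - poly (pcompose p [:b, 1:]) (x - b)\<bar> \<le> C * \<bar>x - b\<bar> ^ n"
        using \<delta>(1) by (intro exI[of _ \<delta>] conjI exI[of _ 0] AE_I2) auto
    qed
  qed
next
  fix f :: "real \<Rightarrow> real"
  assume f: "locally_integrable f" "polynomial_growth f"
  have "signature \<kappa> (distr_of f) b = 0" if b: "b \<notin> distr_supp (distr_of f)" for b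
  proof -
    obtain U where U: "open U" "b \<in> U"
      and zero: "\<forall>\<phi>. test_function \<phi> \<and> fun_supp \<phi> \<subseteq> U \<longrightarrow> distr_of f \<phi> = 0"
      using b unfolding distr_supp_def by auto
    have "\<exists>\<delta>>0. AE x in lborel. \<bar>x - b\<bar> < \<delta> \<longrightarrow> f x = 0"
      by (rule AE_zero_near_if_distr_zero[OF f U]) (simp add: zero)
    then obtain \<delta> where \<delta>: "\<delta> > 0" "AE x in lborel. \<bar>x - b\<bar> < \<delta> \<longrightarrow> f x = 0" by blast
    show ?thesis
    proof (rule signature_zero_if_flat[OF assms f])
      fix n
      have "AE x in lborel. \<bar>x - b\<bar> < \<delta> \<longrightarrow> \<bar>f x - poly 0 (x - b)\<bar> \<le> 0 * \<bar>x - b\<bar> ^ n"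
        using \<delta>(2) by eventually_elim auto
      then show "\<exists>\<delta>>0. \<exists>C. AE x in lborel. \<bar>x - b\<bar> < \<delta> \<longrightarrow> \<bar>f x - poly 0 (x - b)\<bar> \<le> C * \<bar>x - b\<bar> ^ n"
        using \<delta>(1) by blast
    qed
  qed
  moreover have "closed (distr_supp (distr_of f))"
    unfolding distr_supp_def by (intro closed_Compl open_Union) auto
  ultimately show "fun_supp (signature \<kappa> (distr_of f)) \<subseteq> distr_supp (distr_of f)"
    unfolding fun_supp_def by (intro closure_minimal) auto
qed

end
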